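(* Consider the distributed-delay system (D) described in the context, with given continuous initial data $x_{i,0}:[-\bar\tau,0]\to\mathbb{R}^d$, $i=0,1,\dots,N$, and let $$B:=\int_0^{\bar\tau}\beta(s)\,ds,\qquad R:=\max_{i\in\{0,1,\dots,N\}}\ \max_{s\in[-\bar\tau,0]}|x_{i,0}(s)|,\qquad R_\gamma:=\gamma L R+\gamma+1 .$$ Assume that $$\bar\tau<\ln\left(1+\frac{\gamma\,\phi(2R)}{4R_\gamma B(1+\gamma)+\gamma\,\phi(2R)\,B(1+2\gamma)}\right)\qquad\text{and}\qquad\phi\left(\frac\delta2\right)>\frac1{2\gamma}.$$ Then for every $\bar x\in\mathbb{R}^d$ there exists a (measurable) control $u:[0,+\infty)\to\mathbb{R}^d$ such that the corresponding solution of (D) satisfies $$\lim_{t\to+\infty}x_i(t)=\bar x\qquad\text{for any } i\in\{0,1,\dots,N\}.$$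
   Context: Setting. $N,d\in\mathbb{N}$, $|\cdot|$ is the Euclidean norm on $\mathbb{R}^d$, $\gamma>0$ is a constant. The delay $\tau:[0,+\infty)\to(0,+\infty)$ is continuous and there are constants $\bar\tau,\tau_*>0$ with $\tau_*\le\tau(t)\le\bar\tau$ for all $t\ge0$. The weight $\beta:[0,\bar\tau]\to\mathbb{R}^+$ is a nonnegative integrable function with $\int_0^{\tau_*}\beta(s)\,ds>0$, and $h(t):=\int_0^{\tau(t)}\beta(s)\,ds$ for $t\ge 0$ (hence $h(t)>0$). The function $a:[0,+\infty)\to[0,+\infty)$ is continuous and non-increasing, with $a(s)=1$ for $s\in[0,\delta]$ and $a(s)=0$ for $s\ge r$, where $r>\delta>0$. The function $\phi:[0,+\infty)\to(0,+\infty)$ is non-increasing and Lipschitz continuous with Lipschitz constant $L>0$, and $\phi(0)=1$. System (D): $x_0$ (leader) and $x_1,\dots,x_N$ (agents) are $\mathbb{R}^d$-valued functions with, for $t\ge0$ and $i=1,\dots,N$, $$\frac{dx_0}{dt}(t)=u(t),$$ $$\frac{dx_i}{dt}(t)=\frac1{N h(t)}\sum_{j\in\{1,\dots,N\},\,j\ne i}\int_{t-\tau(t)}^t\beta(t-s)\,a_{ij}(t;s)\,(x_j(s)-x_i(t))\,ds+\frac{\gamma}{h(t)}\int_{t-\tau(t)}^t\beta(t-s)\,\phi(|x_0(s)-x_i(t)|)\,(x_0(s)-x_i(t))\,ds,$$ where $a_{ij}(t;s)=a(|x_j(s)-x_i(t)|)$, and with prescribed continuous initial data $x_i(s)=x_{i,0}(s)$,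 $s\in[-\bar\tau,0]$, $i=0,1,\dots,N$. A solution consists of continuous functions on $[-\bar\tau,+\infty)$, locally absolutely continuous on $[0,+\infty)$, satisfying the equations for almost every $t\ge0$. Well-posedness of the system for continuous initial data is taken as known. *)

theory Defs
  imports "HOL-Analysis.Analysis"
begin

definition abs_continuous_on :: "real \<Rightarrow> real \<Rightarrow> (real \<Rightarrow> 'a::real_normed_vector) \<Rightarrow> bool" where
  "abs_continuous_on p q f \<longleftrightarrow>
     (\<forall>\<epsilon>>0. \<exists>\<eta>>0. \<forall>(n::nat) (l::nat \<Rightarrow> real) (r::nat \<Rightarrow> real).
        (\<forall>k<n. p \<le> l k \<and> l k \<le> r k \<and> r k \<le> q) \<longrightarrow>
        disjoint_family_on (\<lambda>k. {l k<..<r k}) {..<n} \<longrightarrow>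
        (\<Sum>k<n. r k - l k) < \<eta> \<longrightarrow>
        (\<Sum>k<n. norm (f (r k) - f (l k))) < \<epsilon>)"

definition locally_abs_continuous :: "(real \<Rightarrow> 'a::real_normed_vector) \<Rightarrow> bool" where
  "locally_abs_continuous f \<longleftrightarrow> (\<forall>T>0. abs_continuous_on 0 T f)"

definition delay_mass :: "(real \<Rightarrow> real) \<Rightarrow> (real \<Rightarrow> real) \<Rightarrow> real \<Rightarrow> real" where
  "delay_mass \<beta> \<tau> t = (LINT s:{0..\<tau> t}|lebesgue. \<beta> s)"

(* Integrals are taken with respect to lebesgue rather than lborel: the weight is only assumed
   Lebesgue integrable, hence need not be Borel measurable. *)
definition agent_velocity ::
  "nat \<Rightarrow> real \<Rightarrow> (real \<Rightarrow> real) \<Rightarrow> (real \<Rightarrow> real) \<Rightarrow> (real \<Rightarrow> real) \<Rightarrow> (real \<Rightarrow> real)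
   \<Rightarrow> (nat \<Rightarrow> real \<Rightarrow> real ^ 'd) \<Rightarrow> nat \<Rightarrow> real \<Rightarrow> real ^ 'd" where
  "agent_velocity N \<gamma> \<tau> \<beta> a \<phi> x i t =
     (1 / (real N * delay_mass \<beta> \<tau> t)) *\<^sub>R
       (\<Sum>j\<in>{1..N} - {i}. LINT s:{t - \<tau> t..t}|lebesgue.
          (\<beta> (t - s) * a (norm (x j s - x i t))) *\<^sub>R (x j s - x i t))
     + (\<gamma> / delay_mass \<beta> \<tau> t) *\<^sub>R
       (LINT s:{t - \<tau> t..t}|lebesgue.
          (\<beta> (t - s) * \<phi> (norm (x 0 s - x i t))) *\<^sub>R (x 0 s - x i t))"

(* Index 0 is the leader, indices 1..N are the agents; xin is the initial history. Values of
   x, xin and u at other indices or outside the stated time ranges are irrelevant. *)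
definition is_solution ::
  "nat \<Rightarrow> real \<Rightarrow> real \<Rightarrow> (real \<Rightarrow> real) \<Rightarrow> (real \<Rightarrow> real) \<Rightarrow> (real \<Rightarrow> real) \<Rightarrow> (real \<Rightarrow> real)
   \<Rightarrow> (nat \<Rightarrow> real \<Rightarrow> real ^ 'd) \<Rightarrow> (real \<Rightarrow> real ^ 'd) \<Rightarrow> (nat \<Rightarrow> real \<Rightarrow> real ^ 'd) \<Rightarrow> bool" where
  "is_solution N \<gamma> \<tau>bar \<tau> \<beta> a \<phi> xin u x \<longleftrightarrow>
     (\<forall>i\<le>N. continuous_on {-\<tau>bar..} (x i) \<and> locally_abs_continuous (x i)
            \<and> (\<forall>s\<in>{-\<tau>bar..0}. x i s = xin i s)) \<and>
     (AE t in lebesgue. t \<ge> 0 \<longrightarrow> (x 0 has_vector_derivative u t) (at t)) \<and>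
     (\<forall>i\<in>{1..N}. AE t in lebesgue. t \<ge> 0 \<longrightarrow>
        (x i has_vector_derivative agent_velocity N \<gamma> \<tau> \<beta> a \<phi> x i t) (at t))"

end

theory Submission
  imports Defs "HOL-Complex_Analysis.Great_Picard" "HOL-Real_Asymp.Real_Asymp"
begin

text \<open>
  The control is open loop: during the first time unit the leader is driven along the straight
  segment from its initial position to \<open>xbar\<close>, and from then on it stays there.  Once the whole
  delay window lies after the arrival of the leader, the system is dissipative around \<open>xbar\<close>.  Put
  \<open>v i = x i - xbar\<close>.  The attraction by the leader contributes \<open>- \<gamma> \<phi>(|v i|) |v i|\<^sup>2\<close> to
  \<open>v i \<bullet> v i'\<close>.  The other agents pull \<open>v i\<close> outwards only if some of them were farther from \<open>xbar\<close>
  during the delay window: if all past distances are at most \<open>q |v i|\<close>, their contribution is at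
  most \<open>(q - 1) |v i|\<^sup>2\<close>, because the weights \<open>a\<close> lie in \<open>[0, 1]\<close> and \<open>h\<close> normalises the window
  (\<open>agent_velocity_inner_le\<close>).  An exponential barrier \<open>C exp (- \<mu> t)\<close> grows backwards over the window by
  at most the factor \<open>q = exp (\<mu> \<tau>bar)\<close>, which is as close to \<open>1\<close> as desired for small \<open>\<mu>\<close>; so the
  leader wins at the first time when a trajectory would touch the barrier, and no trajectory ever
  does (\<open>halanay_decay\<close>).  The barrier starts at a bound \<open>C\<close> for all distances in the initial window,
  hence \<open>\<phi>\<close> is evaluated only at distances up to \<open>C\<close>, where it is at least \<open>\<phi> C > 0\<close>.

  Two facts connect this argument with the notion of solution.  A solution is only absolutely
  continuous and satisfies the equations almost everywhere; the fundamental theorem of calculus for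
  absolutely continuous functions (\<open>ftc_abs_continuous\<close>) turns this into an integral equation with a
  continuous integrand, so the equations hold at every positive time.  Moreover a solution has to
  exist.  Since \<open>a\<close> is merely continuous, no contraction principle applies, and existence is proved as
  in Peano's theorem (\<open>solution_exists\<close>): the Tonelli approximations, in which the right-hand side sees
  the state with an additional delay \<open>e\<close>, are equi-Lipschitz on bounded time intervals, and a
  subsequence converges pointwise as \<open>e\<close> tends to \<open>0\<close>.
\<close>

section \<open>Absolutely continuous functions\<close>

text \<open>
  The definition of absolute continuity is phrased with indexed families of endpoints; divisions are
  the form in which tagged partitions of the Henstock--Kurzweil integral deliver the intervals.
\<close>
lemma abs_continuous_on_division:
  fixes f :: "real \<Rightarrow> 'a::real_normed_vector"
  assumes "abs_continuous_on p q f" "\<epsilon> > 0"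
  obtains \<eta> where "\<eta> > 0"
    "\<And>\<D> S. \<D> division_of S \<Longrightarrow> S \<subseteq> {p..q} \<Longrightarrow> measure lebesgue S < \<eta> \<Longrightarrow>
       (\<Sum>K\<in>\<D>. norm (f (Sup K) - f (Inf K))) < \<epsilon>"
proof -
  from assms(1)[unfolded abs_continuous_on_def, THEN spec, THEN mp, OF assms(2)]
  obtain \<eta> where "\<eta> > 0" and \<eta>: "\<forall>(n::nat) l r.
        (\<forall>k<n. p \<le> l k \<and> l k \<le> r k \<and> r k \<le> q) \<longrightarrow>
        disjoint_family_on (\<lambda>k. {l k<..<r k}) {..<n} \<longrightarrow>
        (\<Sum>k<n. r k - l k) < \<eta> \<longrightarrow> (\<Sum>k<n. norm (f (r k) - f (l k))) < \<epsilon>"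
    by (elim exE conjE)
  show thesis
  proof (rule that [OF \<open>\<eta> > 0\<close>])
    fix \<D> S
    assume D: "\<D> division_of S" and S: "S \<subseteq> {p..q}" "measure lebesgue S < \<eta>"
    have "finite \<D>" using D by blast
    then obtain b where b: "bij_betw b {..<card \<D>} \<D>"
      using ex_bij_betw_nat_finite [of \<D>] by (auto simp: lessThan_atLeast0)
    have K: "Inf K \<le> Sup K" "p \<le> Inf K" "Sup K \<le> q"
      "interior K = {Inf K<..<Sup K}" "measure lebesgue K = Sup K - Inf K" if KD: "K \<in> \<D>" for K
    proof -
      obtain u v where uv: "K = {u..v}" "u \<le> v"
        using division_ofD(3,4) [OF D KD] by (metis box_real(2) atLeastatMost_empty_iff2)
      moreover have "K \<subseteq> {p..q}" using division_ofD(2) [OF D KD] S by blast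
      ultimately show "Inf K \<le> Sup K" "p \<le> Inf K" "Sup K \<le> q"
        "interior K = {Inf K<..<Sup K}" "measure lebesgue K = Sup K - Inf K" by auto
    qed
    have bD: "b k \<in> \<D>" if "k < card \<D>" for k
      using b that by (auto simp: bij_betw_def)
    have "(\<Sum>k<card \<D>. norm (f (Sup (b k)) - f (Inf (b k)))) < \<epsilon>"
    proof (rule \<eta> [rule_format])
      show "p \<le> Inf (b k) \<and> Inf (b k) \<le> Sup (b k) \<and> Sup (b k) \<le> q"
        if "k < card \<D>" for k
        using K bD that by simp
      show "disjoint_family_on (\<lambda>k. {Inf (b k)<..<Sup (b k)}) {..<card \<D>}"
        unfolding disjoint_family_on_def
      proof (intro ballI impI)
        fix i j assume ij: "i \<in> {..<card \<D>}" "j \<in> {..<card \<D>}" "i \<noteq> j"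
        then have "b i \<noteq> b j" using b by (auto simp: bij_betw_def inj_on_def)
        then have "interior (b i) \<inter> interior (b j) = {}"
          using division_ofD(5) [OF D] bD ij by auto
        then show "{Inf (b i)<..<Sup (b i)} \<inter> {Inf (b j)<..<Sup (b j)} = {}"
          using ij K(4) bD by simp
      qed
      have "(\<Sum>k<card \<D>. Sup (b k) - Inf (b k)) = (\<Sum>K\<in>\<D>. Sup K - Inf K)"
        by (rule sum.reindex_bij_betw [OF b])
      also have "\<dots> = (\<Sum>K\<in>\<D>. measure lebesgue K)"
        using K(5) by simp
      also have "\<dots> = measure lebesgue S"
        using content_division [OF D] by simp
      finally show "(\<Sum>k<card \<D>. Sup (b k) - Inf (b k)) < \<eta>" using S by simp
    qed
    then show "(\<Sum>K\<in>\<D>. norm (f (Sup K) - f (Inf K))) < \<epsilon>"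
      by (simp add: sum.reindex_bij_betw [OF b, of "\<lambda>K. norm (f (Sup K) - f (Inf K))"])
  qed
qed

text \<open>
  A gauge argument.  At a tag outside \<open>E\<close> the increment of \<open>f\<close> over the interval differs from the
  Riemann term by a small multiple of the length.  The intervals tagged in \<open>E\<close> are forced by the
  gauge into an open set \<open>G \<supseteq> E\<close> of small measure, so absolute continuity makes the sum of the
  increments over them small; their Riemann terms vanish after replacing \<open>g\<close> by \<open>0\<close> on \<open>E\<close>.
\<close>
theorem ftc_abs_continuous:
  fixes f :: "real \<Rightarrow> 'a::banach"
  assumes "p \<le> q" and ac: "abs_continuous_on p q f" and E: "negligible E"
    and der: "\<And>x. x \<in> {p..q} - E \<Longrightarrow> (f has_vector_derivative g x) (at x within {p..q})"
  shows "(g has_integral f q - f p) {p..q}"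
proof -
  define g0 where "g0 x = (if x \<in> E then 0 else g x)" for x
  have "(g0 has_integral f q - f p) {p..q}"
    unfolding has_integral_real
  proof (intro allI impI)
    fix e :: real assume "e > 0"
    define c where "c = e / (2 * (q - p + 1))"
    have "c > 0" using \<open>e > 0\<close> \<open>p \<le> q\<close> by (simp add: c_def)
    have "e / 2 > 0" using \<open>e > 0\<close> by simp
    then obtain \<eta> where "\<eta> > 0" and \<eta>: "\<And>\<D> S. \<D> division_of S \<Longrightarrow> S \<subseteq> {p..q} \<Longrightarrow>
       measure lebesgue S < \<eta> \<Longrightarrow> (\<Sum>K\<in>\<D>. norm (f (Sup K) - f (Inf K))) < e / 2"
      using abs_continuous_on_division [OF ac] by metis
    obtain G where "open G" "E \<subseteq> G" and G: "G \<in> lmeasurable" "measure lebesgue G < \<eta>"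
    proof -
      have Es: "E \<in> sets lebesgue" using E by (simp add: negligible_imp_sets)
      obtain T where T: "open T" "E \<subseteq> T" "T - E \<in> lmeasurable" "emeasure lebesgue (T - E) < ennreal \<eta>"
        using sets_lebesgue_outer_open [OF Es \<open>\<eta> > 0\<close>] .
      have "T \<in> lmeasurable"
        using T E by (metis Diff_partition Un_commute fmeasurable.Un negligible_imp_measurable)
      moreover have "measure lebesgue T = measure lebesgue (T - E)"
        using T(1) E by (metis borel_open measure_Diff_null_set negligible_iff_null_sets sets_completionI_sets sets_lborel)
      ultimately show thesis
        using that T \<open>\<eta> > 0\<close> by (metis emeasure_eq_measure2 ennreal_less_iff measure_nonneg)
    qed
    have "\<exists>d>0. (x \<in> E \<longrightarrow> ball x d \<subseteq> G) \<and> (x \<in> {p..q} - E \<longrightarrow>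
         (\<forall>y\<in>{p..q}. norm (y-x) < d \<longrightarrow> norm (f y - f x - (y-x) *\<^sub>R g x) \<le> c * norm (y-x)))" for x
    proof (cases "x \<in> {p..q} - E")
      case True
      then show ?thesis
        using der [OF True] \<open>c > 0\<close>
        unfolding has_vector_derivative_def has_derivative_within_alt by blast
    next
      case False
      show ?thesis
      proof (cases "x \<in> E")
        case True
        then show ?thesis
          using \<open>open G\<close> \<open>E \<subseteq> G\<close> open_contains_ball by (metis DiffD2 subsetD)
      next
        case False
        with \<open>x \<notin> {p..q} - E\<close> show ?thesis using zero_less_one by blast
      qed
    qed
    then obtain d where d0: "\<And>x. d x > 0" and dG: "\<And>x. x \<in> E \<Longrightarrow> ball x (d x) \<subseteq> G"
      and d: "\<And>x y. \<lbrakk>x \<in> {p..q} - E; y \<in> {p..q}; norm (y-x) < d x\<rbrakk>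
                \<Longrightarrow> norm (f y - f x - (y-x) *\<^sub>R g x) \<le> c * norm (y-x)"
      by metis
    have "norm ((\<Sum>(x,K)\<in>D. measure lborel K *\<^sub>R g0 x) - (f q - f p)) < e"
      if tag: "D tagged_division_of {p..q}" and fine: "(\<lambda>x. ball x (d x)) fine D" for D
    proof -
      define h where "h = (\<lambda>(x, K). measure lborel K *\<^sub>R g0 x - (f (Sup K) - f (Inf K)))"
      define T where "T = {z \<in> D. fst z \<in> E}"
      have "finite D" "T \<subseteq> D" using tag by (auto simp: T_def)
      have K: "x \<in> K" "K \<subseteq> {p..q}" "Inf K \<le> x" "x \<le> Sup K" "Inf K \<in> K" "Sup K \<in> K"
        "measure lborel K = Sup K - Inf K" "K \<subseteq> ball x (d x)"
        if xK: "(x, K) \<in> D" for x K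
      proof -
        have "x \<in> K" "K \<subseteq> {p..q}" "K \<subseteq> ball x (d x)" using xK tag fine by (auto simp: fine_def)
        moreover obtain u v where "K = {u..v}"
          using tag xK by (metis box_real(2) tagged_division_ofD(4))
        ultimately show "x \<in> K" "K \<subseteq> {p..q}" "Inf K \<le> x" "x \<le> Sup K" "Inf K \<in> K" "Sup K \<in> K"
          "measure lborel K = Sup K - Inf K" "K \<subseteq> ball x (d x)" by auto
      qed
      have "(\<Sum>(x,K)\<in>D. measure lborel K *\<^sub>R g0 x) - (f q - f p) = sum h D"
        using additive_tagged_division_1 [OF \<open>p \<le> q\<close> tag, of f]
        by (simp add: h_def sum_subtractf split_def)
      also have "\<dots> = sum h (D - T) + sum h T"
        using \<open>finite D\<close> \<open>T \<subseteq> D\<close> by (simp add: sum.subset_diff)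
      finally have eq: "(\<Sum>(x,K)\<in>D. measure lborel K *\<^sub>R g0 x) - (f q - f p) = sum h (D - T) + sum h T" .
      have "norm (sum h (D - T)) \<le> (\<Sum>(x,K)\<in>D - T. c * (Sup K - Inf K))"
      proof (rule sum_norm_le, safe)
        fix x K assume xK: "(x, K) \<in> D" "(x, K) \<notin> T"
        then have x: "x \<in> {p..q} - E" using K(1,2) [OF xK(1)] by (auto simp: T_def)
        let ?u = "Inf K" and ?v = "Sup K"
        have uv: "?u \<in> K" "?v \<in> K" "?u \<le> x" "x \<le> ?v" using K [OF xK(1)] by auto
        then have "norm (?u - x) < d x" "norm (?v - x) < d x" "?u \<in> {p..q}" "?v \<in> {p..q}"
          using K [OF xK(1)] by (auto simp: dist_norm norm_minus_commute subset_iff)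
        then have 1: "norm (f ?u - f x - (?u - x) *\<^sub>R g x) \<le> c * (x - ?u)"
          "norm (f ?v - f x - (?v - x) *\<^sub>R g x) \<le> c * (?v - x)"
          using d [OF x, of ?u] d [OF x, of ?v] uv by auto
        have hx: "h (x, K) = (f ?u - f x - (?u - x) *\<^sub>R g x) - (f ?v - f x - (?v - x) *\<^sub>R g x)"
          using x by (simp add: h_def g0_def K(7) [OF xK(1)] algebra_simps)
        have "norm (h (x, K)) \<le> c * (x - ?u) + c * (?v - x)"
          unfolding hx using 1 norm_triangle_ineq4 [of "f ?u - f x - (?u - x) *\<^sub>R g x" "f ?v - f x - (?v - x) *\<^sub>R g x"]
          by linarith
        then show "norm (h (x, K)) \<le> c * (?v - ?u)" by (simp add: algebra_simps)
      qed
      also have "\<dots> \<le> (\<Sum>(x,K)\<in>D. c * (Sup K - Inf K))"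
      proof (rule sum_mono2 [OF \<open>finite D\<close>])
        fix z assume "z \<in> D - (D - T)"
        then have "Inf (snd z) \<le> Sup (snd z)" using K(3,4) [of "fst z" "snd z"] by auto
        then show "0 \<le> (case z of (x, K) \<Rightarrow> c * (Sup K - Inf K))" using \<open>c > 0\<close> by (simp add: split_def)
      qed auto
      also have "\<dots> = c * (q - p)"
        using additive_tagged_division_1 [OF \<open>p \<le> q\<close> tag, of "\<lambda>x. x"]
        by (simp add: split_def flip: sum_distrib_left)
      also have "\<dots> < e / 2"
        using \<open>e > 0\<close> \<open>p \<le> q\<close> by (simp add: c_def field_simps)
      finally have A: "norm (sum h (D - T)) < e / 2" .
      let ?U = "\<Union>(snd ` T)"
      have T: "T tagged_partial_division_of {p..q}"
        using tag \<open>T \<subseteq> D\<close> tagged_partial_division_subset by (meson tagged_division_of_def)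
      have TU: "T tagged_division_of ?U" 
        using tagged_partial_division_of_Union_self [OF T] by simp
      have div: "snd ` T division_of ?U" using division_of_tagged_division [OF TU] .
      have "norm (sum h T) \<le> (\<Sum>(x,K)\<in>T. norm (f (Sup K) - f (Inf K)))"
        by (rule sum_norm_le) (auto simp: h_def T_def g0_def norm_minus_commute)
      also have "\<dots> = (\<Sum>K\<in>snd ` T. norm (f (Sup K) - f (Inf K)))"
      proof -
        \<comment> \<open>A set of intervals counts repeated intervals once, which is harmless: only degenerate ones can
          repeat, and they contribute \<open>0\<close>.  At the empty set \<open>Sup\<close> and \<open>Inf\<close> are unspecified, hence the case
          distinction.\<close>
        define v where "v K = (if K = {} then 0 else norm (f (Sup K) - f (Inf K)))" for K :: "real set"
        have ne: "K \<noteq> {}" if "(x, K) \<in> T" for x K using that K(1) \<open>T \<subseteq> D\<close> by blast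
        have "(\<Sum>(x,K)\<in>T. norm (f (Sup K) - f (Inf K))) = (\<Sum>(x,K)\<in>T. v K)"
          using ne by (intro sum.cong refl) (auto simp: v_def)
        also have "\<dots> = sum v (snd ` T)"
        proof (rule sum.over_tagged_division_lemma [OF TU])
          fix a b :: real assume "box a b = {}"
          then show "v (cbox a b) = 0" by (cases "a = b") (auto simp: v_def)
        qed
        also have "\<dots> = (\<Sum>K\<in>snd ` T. norm (f (Sup K) - f (Inf K)))"
          using ne by (intro sum.cong refl) (auto simp: v_def)
        finally show ?thesis .
      qed
      also have "\<dots> < e / 2"
      proof (rule \<eta> [OF div])
        show "?U \<subseteq> {p..q}" using K(2) \<open>T \<subseteq> D\<close> by fastforce
        have "?U \<subseteq> G" using K(8) dG by (fastforce simp: T_def)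
        then have "measure lebesgue ?U \<le> measure lebesgue G"
          using div G by (meson fmeasurableD lmeasurable_division measure_mono_fmeasurable)
        then show "measure lebesgue ?U < \<eta>" using G by simp
      qed
      finally have "norm (sum h T) < e / 2" .
      with A have "norm (sum h (D - T) + sum h T) < e"
        using norm_triangle_ineq [of "sum h (D - T)" "sum h T"] by linarith
      then show ?thesis by (simp add: eq)
    qed
    moreover have "gauge (\<lambda>x. ball x (d x))" using d0 gauge_ball_dependent by blast
    ultimately show "\<exists>\<gamma>. gauge \<gamma> \<and> (\<forall>D. D tagged_division_of {p..q} \<and> \<gamma> fine D \<longrightarrow>
        norm ((\<Sum>(x,K)\<in>D. measure lborel K *\<^sub>R g0 x) - (f q - f p)) < e)"
      by blast
  qed
  then show ?thesis
    by (rule has_integral_spike [OF E, rotated]) (simp add: g0_def)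
qed

lemma lipschitz_imp_abs_continuous_on:
  fixes f :: "real \<Rightarrow> 'a::real_normed_vector"
  assumes lip: "\<And>s t. p \<le> s \<Longrightarrow> s \<le> t \<Longrightarrow> t \<le> q \<Longrightarrow> norm (f t - f s) \<le> C * (t - s)"
  shows "abs_continuous_on p q f"
  unfolding abs_continuous_on_def
proof (intro allI impI)
  fix \<epsilon> :: real assume "0 < \<epsilon>"
  define C' where "C' = \<bar>C\<bar> + 1"
  have C': "0 < C'" "C \<le> C'" by (auto simp: C'_def)
  show "\<exists>\<eta>>0. \<forall>(n::nat) l r. (\<forall>k<n. p \<le> l k \<and> l k \<le> r k \<and> r k \<le> q) \<longrightarrow>
      disjoint_family_on (\<lambda>k. {l k<..<r k}) {..<n} \<longrightarrow> (\<Sum>k<n. r k - l k) < \<eta> \<longrightarrow>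
      (\<Sum>k<n. norm (f (r k) - f (l k))) < \<epsilon>"
  proof (intro exI [of _ "\<epsilon> / C'"] conjI allI impI)
    show "0 < \<epsilon> / C'" using C' \<open>0 < \<epsilon>\<close> by simp
    fix n :: nat and l r :: "nat \<Rightarrow> real"
    assume lr: "\<forall>k<n. p \<le> l k \<and> l k \<le> r k \<and> r k \<le> q" and small: "(\<Sum>k<n. r k - l k) < \<epsilon> / C'"
    have "(\<Sum>k<n. norm (f (r k) - f (l k))) \<le> (\<Sum>k<n. C' * (r k - l k))"
    proof (rule sum_mono)
      fix k assume "k \<in> {..<n}"
      then have k: "p \<le> l k" "l k \<le> r k" "r k \<le> q" using lr by auto
      have "norm (f (r k) - f (l k)) \<le> C * (r k - l k)" using lip k by simp
      also have "\<dots> \<le> C' * (r k - l k)" using C' k by (intro mult_right_mono) auto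
      finally show "norm (f (r k) - f (l k)) \<le> C' * (r k - l k)" .
    qed
    also have "\<dots> = C' * (\<Sum>k<n. r k - l k)" by (simp add: sum_distrib_left)
    also have "\<dots> < \<epsilon>" using small C' by (simp add: field_simps)
    finally show "(\<Sum>k<n. norm (f (r k) - f (l k))) < \<epsilon>" .
  qed
qed

section \<open>Weighted integrals over a moving window\<close>

lemma set_integral_reflect_window:
  fixes G :: "real \<Rightarrow> 'b::euclidean_space"
  shows "(LINT s:{t - c..t}|lebesgue. G s) = (LINT \<sigma>:{0..c}|lebesgue. G (t - \<sigma>))"
proof -
  let ?f = "\<lambda>s. indicator {t - c..t} s *\<^sub>R G s"
  have iff: "has_bochner_integral lebesgue ?f i \<longleftrightarrow> has_bochner_integral lebesgue (\<lambda>\<sigma>. ?f (t - \<sigma>)) i" for i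
    using has_bochner_integral_lebesgue_real_affine_iff [of "-1" ?f i t] by simp
  have "integral\<^sup>L lebesgue ?f = integral\<^sup>L lebesgue (\<lambda>\<sigma>. ?f (t - \<sigma>))"
  proof (cases "integrable lebesgue ?f")
    case True
    then show ?thesis
      using iff [of "integral\<^sup>L lebesgue ?f"] by (simp add: has_bochner_integral_iff)
  next
    case False
    moreover from False have "\<not> integrable lebesgue (\<lambda>\<sigma>. ?f (t - \<sigma>))"
      using iff has_bochner_integral_iff by blast
    ultimately show ?thesis by (simp add: not_integrable_integral_eq)
  qed
  also have "(\<lambda>\<sigma>. ?f (t - \<sigma>)) = (\<lambda>\<sigma>. indicator {0..c} \<sigma> *\<^sub>R G (t - \<sigma>))"
    by (auto simp: indicator_def fun_eq_iff)
  finally show ?thesis by (simp add: set_lebesgue_integral_def)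
qed

lemma set_integrable_scaleR_bounded:
  fixes g :: "'a::euclidean_space \<Rightarrow> 'b::euclidean_space"
  assumes \<beta>: "set_integrable lebesgue A \<beta>" and g: "g \<in> borel_measurable lebesgue"
    and M: "\<And>\<sigma>. \<sigma> \<in> A \<Longrightarrow> norm (g \<sigma>) \<le> M"
  shows "set_integrable lebesgue A (\<lambda>\<sigma>. \<beta> \<sigma> *\<^sub>R g \<sigma>)"
  unfolding set_integrable_def
proof (rule Bochner_Integration.integrable_bound)
  have b: "integrable lebesgue (\<lambda>\<sigma>. indicator A \<sigma> * \<beta> \<sigma>)"
    using \<beta> by (simp add: set_integrable_def)
  then show "integrable lebesgue (\<lambda>\<sigma>. M * (indicator A \<sigma> * \<beta> \<sigma>))" by simp
  have "(\<lambda>\<sigma>. (indicator A \<sigma> * \<beta> \<sigma>) *\<^sub>R g \<sigma>) \<in> borel_measurable lebesgue"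
    using b g by (intro borel_measurable_scaleR) auto
  then show "(\<lambda>\<sigma>. indicator A \<sigma> *\<^sub>R \<beta> \<sigma> *\<^sub>R g \<sigma>) \<in> borel_measurable lebesgue" by simp
  show "AE \<sigma> in lebesgue. norm (indicator A \<sigma> *\<^sub>R \<beta> \<sigma> *\<^sub>R g \<sigma>) \<le> norm (M * (indicator A \<sigma> * \<beta> \<sigma>))"
  proof (rule AE_I2)
    fix \<sigma>
    show "norm (indicator A \<sigma> *\<^sub>R \<beta> \<sigma> *\<^sub>R g \<sigma>) \<le> norm (M * (indicator A \<sigma> * \<beta> \<sigma>))"
    proof (cases "\<sigma> \<in> A")
      case True
      then have "norm (g \<sigma>) \<le> \<bar>M\<bar>" using M by fastforce
      then show ?thesis using True by (simp add: abs_mult mult.commute [of "\<bar>M\<bar>"] mult_left_mono)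
    qed simp
  qed
qed

lemma norm_set_integral_scaleR_le:
  fixes g :: "'a::euclidean_space \<Rightarrow> 'b::euclidean_space"
  assumes \<beta>: "set_integrable lebesgue A \<beta>" "\<And>\<sigma>. \<sigma> \<in> A \<Longrightarrow> 0 \<le> \<beta> \<sigma>"
    and M: "\<And>\<sigma>. \<sigma> \<in> A \<Longrightarrow> norm (g \<sigma>) \<le> M" "0 \<le> M"
  shows "norm (LINT \<sigma>:A|lebesgue. \<beta> \<sigma> *\<^sub>R g \<sigma>) \<le> M * (LINT \<sigma>:A|lebesgue. \<beta> \<sigma>)"
proof -
  have "norm (LINT \<sigma>:A|lebesgue. \<beta> \<sigma> *\<^sub>R g \<sigma>)
      \<le> (LINT \<sigma>|lebesgue. norm (indicator A \<sigma> *\<^sub>R \<beta> \<sigma> *\<^sub>R g \<sigma>))"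
    unfolding set_lebesgue_integral_def by (rule integral_norm_bound)
  also have "\<dots> \<le> (LINT \<sigma>|lebesgue. M * (indicator A \<sigma> *\<^sub>R \<beta> \<sigma>))"
  proof (rule integral_mono')
    show "integrable lebesgue (\<lambda>\<sigma>. M * (indicator A \<sigma> *\<^sub>R \<beta> \<sigma>))"
      using \<beta>(1) by (simp add: set_integrable_def)
    fix \<sigma>
    show "norm (indicator A \<sigma> *\<^sub>R \<beta> \<sigma> *\<^sub>R g \<sigma>) \<le> M * (indicator A \<sigma> *\<^sub>R \<beta> \<sigma>)"
      using M \<beta>(2) by (cases "\<sigma> \<in> A") (auto simp: mult.commute [of M] mult_left_mono)
    show "0 \<le> M * (indicator A \<sigma> *\<^sub>R \<beta> \<sigma>)"
      using M \<beta>(2) by (cases "\<sigma> \<in> A") auto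
  qed
  also have "\<dots> = M * (LINT \<sigma>:A|lebesgue. \<beta> \<sigma>)"
    by (simp add: set_lebesgue_integral_def)
  finally show ?thesis .
qed

text \<open>
  Dominated convergence; the indicator functions of the windows converge at every point except
  possibly at the endpoint \<open>d\<close>.
\<close>
lemma window_integral_tendsto:
  fixes g :: "real \<Rightarrow> 'b::euclidean_space"
  assumes \<beta>: "set_integrable lebesgue {0..b} \<beta>"
    and c: "c \<longlonglongrightarrow> d" "\<And>n. c n \<le> b" "d \<le> b"
    and meas: "\<And>n. G n \<in> borel_measurable lebesgue" "g \<in> borel_measurable lebesgue"
    and M: "\<And>n \<sigma>. \<sigma> \<in> {0..b} \<Longrightarrow> norm (G n \<sigma>) \<le> M"
    and lim: "\<And>\<sigma>. \<sigma> \<in> {0..b} \<Longrightarrow> (\<lambda>n. G n \<sigma>) \<longlonglongrightarrow> g \<sigma>"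
  shows "(\<lambda>n. LINT \<sigma>:{0..c n}|lebesgue. \<beta> \<sigma> *\<^sub>R G n \<sigma>) \<longlonglongrightarrow> (LINT \<sigma>:{0..d}|lebesgue. \<beta> \<sigma> *\<^sub>R g \<sigma>)"
  unfolding set_lebesgue_integral_def
proof (rule integral_dominated_convergence)
  have b: "integrable lebesgue (\<lambda>\<sigma>. indicator {0..b} \<sigma> * \<beta> \<sigma>)"
    using \<beta> by (simp add: set_integrable_def)
  then show "integrable lebesgue (\<lambda>\<sigma>. \<bar>M\<bar> * \<bar>indicator {0..b} \<sigma> * \<beta> \<sigma>\<bar>)" by simp
  have m: "(\<lambda>\<sigma>. indicator {0..e} \<sigma> *\<^sub>R \<beta> \<sigma> *\<^sub>R f \<sigma>) \<in> borel_measurable lebesgue"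
    if "e \<le> b" "f \<in> borel_measurable lebesgue" for e and f :: "real \<Rightarrow> 'b"
  proof -
    have "(\<lambda>\<sigma>. indicator {0..e} \<sigma> *\<^sub>R (indicator {0..b} \<sigma> * \<beta> \<sigma>) *\<^sub>R f \<sigma>) \<in> borel_measurable lebesgue"
      using b that by (intro borel_measurable_scaleR borel_measurable_indicator) auto
    moreover have "(\<lambda>\<sigma>. indicator {0..e} \<sigma> *\<^sub>R (indicator {0..b} \<sigma> * \<beta> \<sigma>) *\<^sub>R f \<sigma>)
        = (\<lambda>\<sigma>. indicator {0..e} \<sigma> *\<^sub>R \<beta> \<sigma> *\<^sub>R f \<sigma>)"
      using \<open>e \<le> b\<close> by (auto simp: indicator_def fun_eq_iff)
    ultimately show ?thesis by simp
  qed
  show "(\<lambda>\<sigma>. indicator {0..d} \<sigma> *\<^sub>R \<beta> \<sigma> *\<^sub>R g \<sigma>) \<in> borel_measurable lebesgue" using m c meas by simp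
  show "(\<lambda>\<sigma>. indicator {0..c n} \<sigma> *\<^sub>R \<beta> \<sigma> *\<^sub>R G n \<sigma>) \<in> borel_measurable lebesgue" for n
    using m c meas by simp
  show "AE \<sigma> in lebesgue. norm (indicator {0..c n} \<sigma> *\<^sub>R \<beta> \<sigma> *\<^sub>R G n \<sigma>)
      \<le> \<bar>M\<bar> * \<bar>indicator {0..b} \<sigma> * \<beta> \<sigma>\<bar>" for n
  proof (rule AE_I2)
    fix \<sigma>
    show "norm (indicator {0..c n} \<sigma> *\<^sub>R \<beta> \<sigma> *\<^sub>R G n \<sigma>) \<le> \<bar>M\<bar> * \<bar>indicator {0..b} \<sigma> * \<beta> \<sigma>\<bar>"
    proof (cases "\<sigma> \<in> {0..c n}")
      case True
      then have "\<sigma> \<in> {0..b}" using c(2) [of n] by auto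
      moreover from this have "norm (G n \<sigma>) \<le> \<bar>M\<bar>" using M [of \<sigma> n] by linarith
      ultimately show ?thesis using True by (simp add: abs_mult mult.commute [of "\<bar>M\<bar>"] mult_left_mono)
    qed simp
  qed
  have "AE \<sigma> in lebesgue. \<sigma> \<noteq> d"
    by (rule AE_I' [of "{d}"]) (auto simp flip: negligible_iff_null_sets)
  then show "AE \<sigma> in lebesgue. (\<lambda>n. indicator {0..c n} \<sigma> *\<^sub>R \<beta> \<sigma> *\<^sub>R G n \<sigma>)
      \<longlonglongrightarrow> indicator {0..d} \<sigma> *\<^sub>R \<beta> \<sigma> *\<^sub>R g \<sigma>"
  proof (rule AE_mp, intro AE_I2 impI)
    fix \<sigma> assume "\<sigma> \<noteq> d"
    show "(\<lambda>n. indicator {0..c n} \<sigma> *\<^sub>R \<beta> \<sigma> *\<^sub>R G n \<sigma>) \<longlonglongrightarrow> indicator {0..d} \<sigma> *\<^sub>R \<beta> \<sigma> *\<^sub>R g \<sigma>"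
    proof (cases "0 \<le> \<sigma> \<and> \<sigma> < d")
      case True
      then have "eventually (\<lambda>n. \<sigma> < c n) sequentially" using c(1) by (simp add: order_tendstoD)
      then have "eventually (\<lambda>n. \<beta> \<sigma> *\<^sub>R G n \<sigma> = indicator {0..c n} \<sigma> *\<^sub>R \<beta> \<sigma> *\<^sub>R G n \<sigma>) sequentially"
        by eventually_elim (use True in simp)
      moreover have "(\<lambda>n. \<beta> \<sigma> *\<^sub>R G n \<sigma>) \<longlonglongrightarrow> indicator {0..d} \<sigma> *\<^sub>R \<beta> \<sigma> *\<^sub>R g \<sigma>"
        using True c(3) by (auto intro!: tendsto_intros lim)
      ultimately show ?thesis by (rule Lim_transform_eventually [rotated])
    next
      case False
      have "eventually (\<lambda>n. \<sigma> \<notin> {0..c n}) sequentially"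
      proof (cases "0 \<le> \<sigma>")
        case True
        then have "d < \<sigma>" using False \<open>\<sigma> \<noteq> d\<close> by simp
        then have "eventually (\<lambda>n. c n < \<sigma>) sequentially" using c(1) by (simp add: order_tendstoD)
        then show ?thesis by eventually_elim simp
      qed simp
      then have "eventually (\<lambda>n. 0 = indicator {0..c n} \<sigma> *\<^sub>R \<beta> \<sigma> *\<^sub>R G n \<sigma>) sequentially"
        by eventually_elim simp
      moreover have "indicator {0..d} \<sigma> *\<^sub>R \<beta> \<sigma> *\<^sub>R g \<sigma> = 0" using False \<open>\<sigma> \<noteq> d\<close> by (auto simp: indicator_def)
      ultimately show ?thesis by (simp only: tendsto_eventually eq_commute [of 0])
    qed
  qed
qed

text \<open>
  The bound \<open>m\<close> may be negative: this is how the attraction by the leader becomes a strictly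
  dissipative term.
\<close>
lemma inner_set_integral_scaleR_le:
  fixes g :: "'a::euclidean_space \<Rightarrow> 'b::euclidean_space"
  assumes \<beta>: "set_integrable lebesgue A \<beta>" "\<And>\<sigma>. \<sigma> \<in> A \<Longrightarrow> 0 \<le> \<beta> \<sigma>"
    and g: "g \<in> borel_measurable lebesgue" "\<And>\<sigma>. \<sigma> \<in> A \<Longrightarrow> norm (g \<sigma>) \<le> M"
    and m: "\<And>\<sigma>. \<sigma> \<in> A \<Longrightarrow> v \<bullet> g \<sigma> \<le> m"
  shows "v \<bullet> (LINT \<sigma>:A|lebesgue. \<beta> \<sigma> *\<^sub>R g \<sigma>) \<le> m * (LINT \<sigma>:A|lebesgue. \<beta> \<sigma>)"
proof -
  have int: "integrable lebesgue (\<lambda>\<sigma>. indicator A \<sigma> *\<^sub>R \<beta> \<sigma> *\<^sub>R g \<sigma>)"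
    using set_integrable_scaleR_bounded [OF \<beta>(1) g] by (simp add: set_integrable_def)
  then have "v \<bullet> (LINT \<sigma>:A|lebesgue. \<beta> \<sigma> *\<^sub>R g \<sigma>) = (LINT \<sigma>|lebesgue. v \<bullet> (indicator A \<sigma> *\<^sub>R \<beta> \<sigma> *\<^sub>R g \<sigma>))"
    unfolding set_lebesgue_integral_def by (simp only: integral_inner_right)
  also have "\<dots> \<le> (LINT \<sigma>|lebesgue. m * (indicator A \<sigma> *\<^sub>R \<beta> \<sigma>))"
  proof (rule integral_mono)
    show "integrable lebesgue (\<lambda>\<sigma>. v \<bullet> (indicator A \<sigma> *\<^sub>R \<beta> \<sigma> *\<^sub>R g \<sigma>))"
      using int by (intro integrable_inner_right) simp
    show "integrable lebesgue (\<lambda>\<sigma>. m * (indicator A \<sigma> *\<^sub>R \<beta> \<sigma>))"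
      using \<beta>(1) by (simp add: set_integrable_def)
    fix \<sigma>
    show "v \<bullet> (indicator A \<sigma> *\<^sub>R \<beta> \<sigma> *\<^sub>R g \<sigma>) \<le> m * (indicator A \<sigma> *\<^sub>R \<beta> \<sigma>)"
      using mult_left_mono [OF m \<beta>(2), of \<sigma> \<sigma>] by (cases "\<sigma> \<in> A") (auto simp: mult.commute)
  qed
  also have "\<dots> = m * (LINT \<sigma>:A|lebesgue. \<beta> \<sigma>)"
    by (simp add: set_lebesgue_integral_def)
  finally show ?thesis .
qed

section \<open>Existence of solutions of equations with memory\<close>

lemma continuous_on_locally_lipschitz:
  fixes f :: "real \<Rightarrow> 'b::real_normed_vector"
  assumes "\<And>T s t. s \<le> t \<Longrightarrow> t \<le> T \<Longrightarrow> norm (f t - f s) \<le> C T * (t - s)"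
  shows "continuous_on UNIV f"
proof -
  have "continuous_on {..<T} f" for T
  proof -
    have *: "dist (f t) (f s) \<le> \<bar>C T\<bar> * dist t s" if "s \<le> t" "t < T" for s t
      using assms [of s t T] that mult_right_mono [OF abs_ge_self, of "t - s" "C T"]
      by (simp add: dist_norm)
    have "\<bar>C T\<bar>-lipschitz_on {..<T} f"
    proof (rule lipschitz_onI)
      fix t s assume "t \<in> {..<T}" "s \<in> {..<T}"
      then show "dist (f t) (f s) \<le> \<bar>C T\<bar> * dist t s"
        using * [of s t] * [of t s] by (cases "s \<le> t") (auto simp: dist_commute)
    qed simp
    then show ?thesis by (rule lipschitz_on_continuous_on)
  qed
  then have "continuous_on (\<Union>T\<in>UNIV. {..<T}) f" by (intro continuous_on_open_UN) auto
  moreover have "(\<Union>T\<in>UNIV. {..<T}) = (UNIV :: real set)" using lt_ex gt_ex by blast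
  ultimately show ?thesis by simp
qed

text \<open>
  The right-hand side of an equation with memory, for the components \<open>0, \<dots>, N\<close>: the velocity of
  component \<open>j\<close> at time \<open>t\<close> may depend on all components at all times up to \<open>t\<close>.  The convergence
  assumption looks at histories relative to the current time; it expresses continuity in time,
  continuity with respect to the history and, by constant sequences, causality.
\<close>
locale memory_field =
  fixes N :: nat and K :: real and F :: "(nat \<Rightarrow> real \<Rightarrow> 'b::euclidean_space) \<Rightarrow> nat \<Rightarrow> real \<Rightarrow> 'b"
  assumes K_pos: "0 < K"
    and growth: "\<And>y j t M. \<lbrakk>0 \<le> t; j \<le> N; \<And>m s. m \<le> N \<Longrightarrow> s \<le> t \<Longrightarrow> norm (y m s) \<le> M\<rbrakk>
        \<Longrightarrow> norm (F y j t) \<le> K * (1 + M)"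
    and field_tendsto: "\<And>t t0 y y0 j M. \<lbrakk>t \<longlonglongrightarrow> t0; \<And>n. 0 \<le> t n; 0 \<le> t0; j \<le> N;
        \<And>n m. m \<le> N \<Longrightarrow> continuous_on UNIV (y n m); \<And>m. m \<le> N \<Longrightarrow> continuous_on UNIV (y0 m);
        \<And>n m \<sigma>. m \<le> N \<Longrightarrow> 0 \<le> \<sigma> \<Longrightarrow> norm (y n m (t n - \<sigma>)) \<le> M;
        \<And>m \<sigma>. m \<le> N \<Longrightarrow> 0 \<le> \<sigma> \<Longrightarrow> (\<lambda>n. y n m (t n - \<sigma>)) \<longlonglongrightarrow> y0 m (t0 - \<sigma>)\<rbrakk>
        \<Longrightarrow> (\<lambda>n. F (y n) j (t n)) \<longlonglongrightarrow> F y0 j t0"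
begin

definition history :: "(nat \<Rightarrow> real \<Rightarrow> 'b) \<Rightarrow> bool" where
  "history y \<longleftrightarrow> (\<forall>m\<le>N. continuous_on UNIV (y m)) \<and> (\<forall>T. \<exists>M. \<forall>m\<le>N. \<forall>s\<le>T. norm (y m s) \<le> M)"

lemma field_continuous:
  assumes y: "history y" and j: "j \<le> N"
  shows "continuous_on {0..} (F y j)"
  unfolding continuous_on_sequentially
proof (intro allI ballI impI)
  fix t t0 assume "t0 \<in> {0::real..}" and t: "(\<forall>n. t n \<in> {0..}) \<and> t \<longlonglongrightarrow> t0"
  have "Bseq t" using t convergentI convergent_imp_Bseq by blast
  then obtain T where "\<And>n. norm (t n) \<le> T" by (auto simp: Bseq_def)
  then have T: "t n \<le> T" for n by (simp add: abs_le_iff)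
  obtain M where M: "\<And>m s. m \<le> N \<Longrightarrow> s \<le> T \<Longrightarrow> norm (y m s) \<le> M"
    using y unfolding history_def by metis
  have c: "continuous_on UNIV (y m)" if "m \<le> N" for m using y that unfolding history_def by blast
  have "(\<lambda>n. F y j (t n)) \<longlonglongrightarrow> F y j t0"
  proof (rule field_tendsto [where M = M])
    show "norm (y m (t n - \<sigma>)) \<le> M" if "m \<le> N" "0 \<le> \<sigma>" for n m \<sigma>
      using M [OF that(1)] T [of n] that(2) by simp
    show "(\<lambda>n. y m (t n - \<sigma>)) \<longlonglongrightarrow> y m (t0 - \<sigma>)" if "m \<le> N" for m \<sigma>
      using t by (intro continuous_on_tendsto_compose [OF c [OF that]] tendsto_intros) auto
  qed (use t j c \<open>t0 \<in> {0..}\<close> in auto)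
  then show "(F y j \<circ> t) \<longlonglongrightarrow> F y j t0" by (simp add: comp_def)
qed

text \<open>Two histories that agree up to \<open>t\<close> form a constant sequence converging to either of them.\<close>
lemma field_causal:
  assumes y: "history y" "history y'" and "j \<le> N" "0 \<le> t"
    and eq: "\<And>m s. m \<le> N \<Longrightarrow> s \<le> t \<Longrightarrow> y m s = y' m s"
  shows "F y j t = F y' j t"
proof -
  obtain M where M: "\<And>m s. m \<le> N \<Longrightarrow> s \<le> t \<Longrightarrow> norm (y m s) \<le> M"
    using y(1) unfolding history_def by metis
  have c: "continuous_on UNIV (y m)" "continuous_on UNIV (y' m)" if "m \<le> N" for m
    using y that by (auto simp: history_def)
  have "(\<lambda>n::nat. F y j t) \<longlonglongrightarrow> F y' j t"
  proof (rule field_tendsto [where M = M])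
    show "(\<lambda>n. y m (t - \<sigma>)) \<longlonglongrightarrow> y' m (t - \<sigma>)" if "m \<le> N" "0 \<le> \<sigma>" for m \<sigma>
      using eq [of m "t - \<sigma>"] that by simp
    show "norm (y m (t - \<sigma>)) \<le> M" if "m \<le> N" "0 \<le> \<sigma>" for m \<sigma>
      using M [OF that(1)] that(2) by simp
  qed (simp_all add: c \<open>j \<le> N\<close> \<open>0 \<le> t\<close>)
  then show ?thesis by (simp add: LIMSEQ_const_iff)
qed

end

locale memory_ivp = memory_field N K F
  for N K and F :: "(nat \<Rightarrow> real \<Rightarrow> 'b::euclidean_space) \<Rightarrow> nat \<Rightarrow> real \<Rightarrow> 'b" +
  fixes z :: "nat \<Rightarrow> real \<Rightarrow> 'b" and R :: real
  assumes z_cont: "\<And>j. j \<le> N \<Longrightarrow> continuous_on UNIV (z j)"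
    and z_bound: "\<And>j s. j \<le> N \<Longrightarrow> s \<le> 0 \<Longrightarrow> norm (z j s) \<le> R"
begin

text \<open>
  The solution of \<open>W' = K (1 + W)\<close> with \<open>W 0 = R\<close>, extended constantly to negative times.  It bounds
  every iterate of the integral operator below, since \<open>growth\<close> bounds velocities by \<open>K (1 + W)\<close>.
\<close>
definition W :: "real \<Rightarrow> real" where "W t = (1 + R) * exp (K * max t 0) - 1"

text \<open>The class of histories that the integral operator maps into itself.\<close>
definition tame :: "(nat \<Rightarrow> real \<Rightarrow> 'b) \<Rightarrow> bool" where
  "tame y \<longleftrightarrow> (\<forall>m\<le>N. continuous_on UNIV (y m) \<and> (\<forall>s. norm (y m s) \<le> W s))"

definition delay :: "real \<Rightarrow> (nat \<Rightarrow> real \<Rightarrow> 'b) \<Rightarrow> nat \<Rightarrow> real \<Rightarrow> 'b" where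
  "delay e y m s = y m (s - e)"

text \<open>
  The Picard operator for the equation with the additional delay \<open>e\<close>.  For \<open>e > 0\<close> its value up to time
  \<open>t\<close> depends on the history up to \<open>t - e\<close> only.
\<close>
definition step :: "real \<Rightarrow> (nat \<Rightarrow> real \<Rightarrow> 'b) \<Rightarrow> nat \<Rightarrow> real \<Rightarrow> 'b" where
  "step e y j t = z j (min t 0) + integral {0..t} (F (delay e y) j)"

lemma R_nonneg: "0 \<le> R"
  using z_bound [of 0 0] norm_ge_zero [of "z 0 0"] by linarith

lemma W_mono: "s \<le> t \<Longrightarrow> W s \<le> W t"
  using R_nonneg K_pos by (auto simp: W_def intro!: mult_left_mono)

lemma W_ge: "R \<le> W t"
proof -
  have "(1 + R) * 1 \<le> (1 + R) * exp (K * max t 0)"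
    using R_nonneg K_pos by (intro mult_left_mono) auto
  then show ?thesis by (simp add: W_def)
qed

lemma tame_history: "tame y \<Longrightarrow> history y"
  unfolding tame_def history_def by (meson W_mono order_trans)

lemma tame_delay: assumes "tame y" "0 \<le> e" shows "tame (delay e y)"
  unfolding tame_def
proof (intro allI impI conjI)
  fix m s assume m: "m \<le> N"
  have "continuous_on UNIV (y m)" using assms m unfolding tame_def by blast
  then have "continuous_on UNIV (\<lambda>s. y m (s - e))"
    by (rule continuous_on_compose2) (auto intro!: continuous_intros)
  then show "continuous_on UNIV (delay e y m)" by (simp add: delay_def [abs_def])
  have "norm (y m (s - e)) \<le> W (s - e)" using assms m unfolding tame_def by blast
  then show "norm (delay e y m s) \<le> W s"
    using W_mono [of "s - e" s] assms(2) by (simp add: delay_def)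
qed

lemma tame_field_bound:
  assumes "tame y" "j \<le> N" "0 \<le> s" "s \<le> T"
  shows "norm (F y j s) \<le> K * (1 + W T)"
proof (rule growth)
  fix m r assume "m \<le> N" "r \<le> s"
  then show "norm (y m r) \<le> W T"
    using assms W_mono [of r T] unfolding tame_def by (meson order_trans)
qed (use assms in auto)

lemma tame_field_integrable:
  assumes "tame y" "j \<le> N" "0 \<le> s"
  shows "continuous_on {s..t} (F y j)" "F y j integrable_on {s..t}"
proof -
  show "continuous_on {s..t} (F y j)"
    using field_continuous [OF tame_history [OF assms(1)] assms(2)]
    by (rule continuous_on_subset) (use assms in auto)
  then show "F y j integrable_on {s..t}" by (rule integrable_continuous_real)
qed

lemma step_initial: "t \<le> 0 \<Longrightarrow> step e y j t = z j t"
  by (cases "t = 0") (auto simp: step_def)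

lemma integral_field_lipschitz:
  assumes "tame y" "j \<le> N" "s \<le> t" "t \<le> T"
  shows "norm (integral {0..t} (F y j) - integral {0..s} (F y j)) \<le> K * (1 + W T) * (t - s)"
proof -
  have C: "0 \<le> K * (1 + W T)" using K_pos W_ge [of T] R_nonneg by simp
  have *: "norm (integral {0..t} (F y j) - integral {0..s} (F y j)) \<le> K * (1 + W T) * (t - s)"
    if "0 \<le> s" "s \<le> t" "t \<le> T" for s t
  proof -
    have "integral {0..t} (F y j) - integral {0..s} (F y j) = integral {s..t} (F y j)"
      using Henstock_Kurzweil_Integration.integral_combine [OF that(1,2) tame_field_integrable(2) [OF assms(1,2)]]
      by (simp add: algebra_simps)
    also have "norm \<dots> \<le> K * (1 + W T) * (t - s)"
      using that by (intro integral_bound tame_field_integrable tame_field_bound assms) auto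
    finally show ?thesis .
  qed
  show ?thesis
  proof (cases "0 \<le> s")
    case True then show ?thesis using * assms by simp
  next
    case False
    then have 0: "integral {0..s} (F y j) = 0" by simp
    show ?thesis
    proof (cases "0 \<le> t")
      case True
      have "norm (integral {0..t} (F y j)) \<le> K * (1 + W T) * t" using * [of 0 t] True assms by simp
      also have "\<dots> \<le> K * (1 + W T) * (t - s)" using False C by (intro mult_left_mono) auto
      finally show ?thesis using 0 by simp
    next
      case False
      then show ?thesis using 0 C assms by simp
    qed
  qed
qed

lemma tame_step:
  assumes "tame y" "0 \<le> e" shows "tame (step e y)"
  unfolding tame_def
proof (intro allI impI conjI)
  fix j assume j: "j \<le> N"
  note d = tame_delay [OF assms]
  have "continuous_on UNIV (\<lambda>t. z j (min t 0))"
    by (rule continuous_on_compose2 [OF z_cont [OF j]]) (auto intro!: continuous_intros)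
  moreover have "continuous_on UNIV (\<lambda>t. integral {0..t} (F (delay e y) j))"
    by (rule continuous_on_locally_lipschitz [where C = "\<lambda>T. K * (1 + W T)"])
      (rule integral_field_lipschitz [OF d j])
  ultimately show "continuous_on UNIV (step e y j)"
    unfolding step_def [abs_def] by (rule continuous_on_add)
  fix t
  show "norm (step e y j t) \<le> W t"
  proof (cases "t \<le> 0")
    case True
    then show ?thesis using order_trans [OF z_bound [OF j True] W_ge] by (simp add: step_initial)
  next
    case False
    have "((\<lambda>s. K * (1 + W s)) has_integral W t - W 0) {0..t}"
    proof -
      have "((\<lambda>s. (1 + R) * exp (K * s)) has_vector_derivative K * (1 + W s)) (at s within {0..t})"
        if "s \<in> {0..t}" for s
        unfolding has_real_derivative_iff_has_vector_derivative [symmetric]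
        using that by (auto intro!: derivative_eq_intros simp: W_def)
      then have "((\<lambda>s. K * (1 + W s)) has_integral (1 + R) * exp (K * t) - (1 + R) * exp (K * 0)) {0..t}"
        using False by (intro fundamental_theorem_of_calculus) auto
      then show ?thesis using False by (simp add: W_def algebra_simps)
    qed
    then have W: "(\<lambda>s. K * (1 + W s)) integrable_on {0..t}"
      "integral {0..t} (\<lambda>s. K * (1 + W s)) = W t - W 0" by (blast, rule integral_unique)
    have "norm (integral {0..t} (F (delay e y) j)) \<le> W t - W 0"
      unfolding W(2) [symmetric]
      by (intro Henstock_Kurzweil_Integration.integral_norm_bound_integral tame_field_integrable W(1) d j)
        (auto intro: tame_field_bound d j)
    moreover have "W 0 = R" by (simp add: W_def)
    ultimately show ?thesis
      using norm_triangle_ineq [of "z j 0" "integral {0..t} (F (delay e y) j)"] z_bound [OF j, of 0] False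
      by (simp add: step_def)
  qed
qed

lemma step_lipschitz:
  assumes "tame y" "0 \<le> e" "j \<le> N" "0 \<le> s" "s \<le> t" "t \<le> T"
  shows "norm (step e y j t - step e y j s) \<le> K * (1 + W T) * (t - s)"
  using integral_field_lipschitz [OF tame_delay [OF assms(1,2)] assms(3,5,6)] assms
  by (simp add: step_def)

text \<open>
  The extra delay makes the integral equation explicit: each application of the operator determines
  the solution on a further interval of length \<open>e\<close>, so finitely many applications give a fixed point
  up to time \<open>T\<close>.
\<close>
lemma delayed_solution_exists:
  assumes e: "0 < e"
  obtains x where "tame x" "\<And>j s. j \<le> N \<Longrightarrow> s \<le> 0 \<Longrightarrow> x j s = z j s"
    "\<And>j t. j \<le> N \<Longrightarrow> t \<le> T \<Longrightarrow> x j t = step e x j t"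
    "\<And>j S s t. \<lbrakk>j \<le> N; 0 \<le> s; s \<le> t; t \<le> S\<rbrakk> \<Longrightarrow> norm (x j t - x j s) \<le> K * (1 + W S) * (t - s)"
proof -
  define Y where "Y k = (step e ^^ k) (\<lambda>j t. z j (min t 0))" for k
  have Y_Suc: "Y (Suc k) = step e (Y k)" for k by (simp add: Y_def)
  have tame: "tame (Y k)" for k
  proof (induction k)
    case 0
    have "continuous_on UNIV (\<lambda>t. z j (min t 0))" if "j \<le> N" for j
      by (rule continuous_on_compose2 [OF z_cont [OF that]]) (auto intro!: continuous_intros)
    then show ?case
      using order_trans [OF z_bound W_ge] by (simp add: Y_def tame_def)
  next
    case (Suc k)
    then show ?case using tame_step e by (simp add: Y_Suc)
  qed
  have agree: "Y (Suc k) j t = Y k j t" if "j \<le> N" "t \<le> k * e" for k j t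
    using that
  proof (induction k arbitrary: j t)
    case 0
    then show ?case using step_initial [of t e "Y 0" j] by (simp add: Y_Suc) (simp add: Y_def)
  next
    case (Suc k)
    have "integral {0..t} (F (delay e (Y (Suc k))) j) = integral {0..t} (F (delay e (Y k)) j)"
    proof (rule integral_cong)
      fix s assume s: "s \<in> {0..t}"
      show "F (delay e (Y (Suc k))) j s = F (delay e (Y k)) j s"
      proof (rule field_causal)
        fix m r assume "m \<le> N" "r \<le> s"
        then show "delay e (Y (Suc k)) m r = delay e (Y k) m r"
          unfolding delay_def using s Suc.prems by (intro Suc.IH) (auto simp: algebra_simps)
      qed (use s Suc.prems tame_history tame_delay tame e in auto)
    qed
    then show ?case by (simp add: Y_Suc [of "Suc k"] Y_Suc [of k] step_def)
  qed
  obtain k :: nat where k: "T \<le> k * e" using reals_Archimedean3 [OF e] less_imp_le by meson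
  show thesis
  proof (rule that [of "Y (Suc k)"])
    show "Y (Suc k) j s = z j s" if "j \<le> N" "s \<le> 0" for j s
      using step_initial that by (simp add: Y_Suc)
    show "Y (Suc k) j t = step e (Y (Suc k)) j t" if "j \<le> N" "t \<le> T" for j t
      using agree [of j t "Suc k"] that k e by (simp add: Y_Suc algebra_simps)
    show "norm (Y (Suc k) j t - Y (Suc k) j s) \<le> K * (1 + W S) * (t - s)"
      if "j \<le> N" "0 \<le> s" "s \<le> t" "t \<le> S" for j S s t
      using step_lipschitz tame e that by (simp add: Y_Suc)
  qed (rule tame)
qed


text \<open>
  The Tonelli approximations \<open>X n\<close> with delay \<open>e n = 1 / (n + 1)\<close> are bounded by \<open>W\<close> and equi-Lipschitz on
  bounded intervals.  A diagonal subsequence converges at all rational times and therefore, by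
  the Lipschitz bounds, at all times; pointwise convergence suffices to pass to the limit in the
  integral equation by dominated convergence.
\<close>
theorem solution_exists:
  obtains x where "tame x" "\<And>j s. j \<le> N \<Longrightarrow> s \<le> 0 \<Longrightarrow> x j s = z j s"
    "\<And>j t. j \<le> N \<Longrightarrow> 0 \<le> t \<Longrightarrow> x j t = z j 0 + integral {0..t} (F x j)"
    "\<And>j S s t. \<lbrakk>j \<le> N; 0 \<le> s; s \<le> t; t \<le> S\<rbrakk> \<Longrightarrow> norm (x j t - x j s) \<le> K * (1 + W S) * (t - s)"
proof -
  define e where "e n = 1 / real (Suc n)" for n
  have e0: "0 < e n" for n by (simp add: e_def)
  have e_lim: "e \<longlonglongrightarrow> 0" unfolding e_def using LIMSEQ_Suc [OF lim_1_over_n] by simp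
  have "\<exists>x. tame x \<and> (\<forall>j\<le>N. \<forall>s\<le>0. x j s = z j s) \<and> (\<forall>j\<le>N. \<forall>t\<le>real n. x j t = step (e n) x j t) \<and>
      (\<forall>j\<le>N. \<forall>S s t. 0 \<le> s \<longrightarrow> s \<le> t \<longrightarrow> t \<le> S \<longrightarrow> norm (x j t - x j s) \<le> K * (1 + W S) * (t - s))" for n
    by (rule delayed_solution_exists [OF e0 [of n], of "real n"]) blast
  then obtain X where X: "\<And>n. tame (X n)"
    and X_init: "\<And>n j s. j \<le> N \<Longrightarrow> s \<le> 0 \<Longrightarrow> X n j s = z j s"
    and X_step: "\<And>n j t. j \<le> N \<Longrightarrow> t \<le> real n \<Longrightarrow> X n j t = step (e n) (X n) j t"
    and X_lip: "\<And>n j S s t. \<lbrakk>j \<le> N; 0 \<le> s; s \<le> t; t \<le> S\<rbrakk>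
        \<Longrightarrow> norm (X n j t - X n j s) \<le> K * (1 + W S) * (t - s)"
    by metis
  have X_W: "norm (X n j s) \<le> W s" if "j \<le> N" for n j s
    using X that unfolding tame_def by blast
  have C_pos: "0 < K * (1 + W S)" for S using K_pos W_ge [of S] R_nonneg by simp
  define Q where "Q = {..N} \<times> (\<rat> \<inter> {0..} :: real set)"
  \<comment> \<open>Division by \<open>1 + W q\<close> makes the bound uniform in \<open>q\<close>, so that one subsequence serves all rational
    times at once.\<close>
  have "countable Q" unfolding Q_def by (intro countable_SIGMA countable_finite countable_Int1 countable_rat) auto
  moreover have "norm ((\<lambda>(j, q). X n j q /\<^sub>R (1 + W q)) p) \<le> 1" if pQ: "p \<in> Q" for n p
  proof -
    obtain j q where p: "p = (j, q)" "j \<le> N" using pQ by (auto simp: Q_def)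
    have "0 < 1 + W q" using W_ge [of q] R_nonneg by simp
    moreover have "norm (X n j q) \<le> 1 + W q" using X_W [OF p(2), of n q] by simp
    ultimately show ?thesis using p(1) by (simp add: divide_simps)
  qed
  ultimately have "\<exists>k. strict_mono k \<and> (\<forall>p\<in>Q. \<exists>l. (\<lambda>n. (\<lambda>(j, q). X (k n) j q /\<^sub>R (1 + W q)) p) \<longlonglongrightarrow> l)"
    by (rule function_convergent_subsequence [of Q "\<lambda>n. \<lambda>(j, q). X n j q /\<^sub>R (1 + W q)" 1])
      (assumption, rule exI, rule conjI, assumption, rule ballI)
  then obtain k where k: "strict_mono k"
    and lim: "\<And>p. p \<in> Q \<Longrightarrow> \<exists>l. (\<lambda>n. (\<lambda>(j, q). X (k n) j q /\<^sub>R (1 + W q)) p) \<longlonglongrightarrow> l"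
    by blast
  have conv_rat: "convergent (\<lambda>n. X (k n) j q)" if jq: "j \<le> N" "q \<in> \<rat>" "0 \<le> q" for j q
  proof -
    obtain l where "(\<lambda>n. X (k n) j q /\<^sub>R (1 + W q)) \<longlonglongrightarrow> l"
      using lim [of "(j, q)"] jq by (auto simp: Q_def)
    then have "(\<lambda>n. (1 + W q) *\<^sub>R (X (k n) j q /\<^sub>R (1 + W q))) \<longlonglongrightarrow> (1 + W q) *\<^sub>R l"
      by (intro tendsto_intros)
    moreover have "1 + W q \<noteq> 0" using W_ge [of q] R_nonneg by simp
    ultimately show ?thesis by (auto simp: convergent_def)
  qed
  have conv: "convergent (\<lambda>n. X (k n) j t)" if j: "j \<le> N" for j t
  proof (cases "t \<le> 0")
    case True
    then show ?thesis using X_init j by (simp add: convergent_const)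
  next
    case False
    have "Cauchy (\<lambda>n. X (k n) j t)"
    proof (rule metric_CauchyI)
      fix \<epsilon> :: real assume "0 < \<epsilon>"
      let ?C = "K * (1 + W (t + 1))"
      have "t < min (t + 1) (t + \<epsilon> / (3 * ?C))" using C_pos [of "t + 1"] \<open>0 < \<epsilon>\<close> by simp
      then obtain q where q: "q \<in> \<rat>" "t < q" "q < min (t + 1) (t + \<epsilon> / (3 * ?C))"
        using Rats_dense_in_real by blast
      have near: "dist (X n j t) (X n j q) < \<epsilon> / 3" for n
      proof -
        have "dist (X n j t) (X n j q) \<le> ?C * (q - t)"
          using X_lip [OF j, of t q "t + 1" n] q False by (simp add: dist_norm norm_minus_commute)
        also have "\<dots> < \<epsilon> / 3" using q C_pos [of "t + 1"] by (simp add: field_simps)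
        finally show ?thesis .
      qed
      obtain M where M: "\<And>m n. M \<le> m \<Longrightarrow> M \<le> n \<Longrightarrow> dist (X (k m) j q) (X (k n) j q) < \<epsilon> / 3"
        using metric_CauchyD [OF convergent_Cauchy [OF conv_rat [OF j q(1)]], of "\<epsilon> / 3"] q False \<open>0 < \<epsilon>\<close>
        by auto
      have "dist (X (k m) j t) (X (k n) j t) < \<epsilon>" if "M \<le> m" "M \<le> n" for m n
        using near [of "k m"] near [of "k n"] M [OF that]
          dist_triangle [of "X (k m) j t" "X (k n) j t" "X (k m) j q"]
          dist_triangle [of "X (k m) j q" "X (k n) j t" "X (k n) j q"]
          dist_commute [of "X (k n) j q" "X (k n) j t"] by linarith
      then show "\<exists>M. \<forall>m\<ge>M. \<forall>n\<ge>M. dist (X (k m) j t) (X (k n) j t) < \<epsilon>" by blast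
    qed
    then show ?thesis by (simp add: Cauchy_convergent_iff)
  qed
  define x where "x j t = lim (\<lambda>n. X (k n) j t)" for j t
  have x: "(\<lambda>n. X (k n) j t) \<longlonglongrightarrow> x j t" if "j \<le> N" for j t
    using conv [OF that] by (simp add: x_def convergent_LIMSEQ_iff)
  have x_init: "x j s = z j s" if "j \<le> N" "s \<le> 0" for j s
    using x [OF that(1), of s] X_init that by (simp add: LIMSEQ_const_iff)
  have x_lip: "norm (x j t - x j s) \<le> K * (1 + W S) * (t - s)"
    if "j \<le> N" "0 \<le> s" "s \<le> t" "t \<le> S" for j S s t
  proof (rule Lim_bounded)
    show "(\<lambda>n. norm (X (k n) j t - X (k n) j s)) \<longlonglongrightarrow> norm (x j t - x j s)"
      using x that by (intro tendsto_intros)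
  qed (use X_lip that in blast)
  have x_W: "norm (x j t) \<le> W t" if "j \<le> N" for j t
  proof (rule Lim_bounded)
    show "(\<lambda>n. norm (X (k n) j t)) \<longlonglongrightarrow> norm (x j t)" using x that by (intro tendsto_intros)
  qed (use X_W that in blast)
  have x_cont: "continuous_on UNIV (x j)" if j: "j \<le> N" for j
  proof -
    have "continuous_on UNIV (\<lambda>t. x j (max t 0))"
    proof (rule continuous_on_locally_lipschitz)
      fix T s t :: real assume st: "s \<le> t" "t \<le> T"
      have "norm (x j (max t 0) - x j (max s 0)) \<le> K * (1 + W (max T 0)) * (max t 0 - max s 0)"
        using st by (intro x_lip [OF j]) auto
      also have "\<dots> \<le> K * (1 + W (max T 0)) * (t - s)"
        using st C_pos [of "max T 0"] by (intro mult_left_mono) auto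
      finally show "norm (x j (max t 0) - x j (max s 0)) \<le> K * (1 + W (max T 0)) * (t - s)" .
    qed
    moreover have "continuous_on UNIV (\<lambda>t. z j (min t 0))"
      by (rule continuous_on_compose2 [OF z_cont [OF j]]) (auto intro!: continuous_intros)
    ultimately have "continuous_on UNIV (\<lambda>t. z j (min t 0) + x j (max t 0) - z j 0)"
      by (intro continuous_intros)
    moreover have "z j (min t 0) + x j (max t 0) - z j 0 = x j t" for t
      using x_init [OF j] by (cases "t \<le> 0") auto
    ultimately show ?thesis by simp
  qed
  have "tame x" using x_cont x_W by (simp add: tame_def)
  have e_k: "(\<lambda>n. e (k n)) \<longlonglongrightarrow> 0"
    using LIMSEQ_subseq_LIMSEQ [OF e_lim k] by (simp add: comp_def)
  have delayed: "(\<lambda>n. delay (e (k n)) (X (k n)) m r) \<longlonglongrightarrow> x m r" if m: "m \<le> N" for m r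
  proof (cases "r \<le> 0")
    case True
    have "(\<lambda>n. z m (r - e (k n))) \<longlonglongrightarrow> z m (r - 0)"
      by (intro continuous_on_tendsto_compose [OF z_cont [OF m]] tendsto_intros e_k) auto
    moreover have "delay (e (k n)) (X (k n)) m r = z m (r - e (k n))" for n
      unfolding delay_def using True e0 [of "k n"] by (intro X_init m) simp
    ultimately show ?thesis using x_init [OF m True] by simp
  next
    case False
    then have "\<forall>\<^sub>F n in sequentially. e (k n) < r" using order_tendstoD(2) [OF e_k] by simp
    then have "\<forall>\<^sub>F n in sequentially. norm (delay (e (k n)) (X (k n)) m r - X (k n) m r) \<le> K * (1 + W r) * e (k n)"
    proof eventually_elim
      case (elim n)
      then show ?case
        using X_lip [OF m, of "r - e (k n)" r r "k n"] e0 [of "k n"] by (simp add: delay_def norm_minus_commute)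
    qed
    moreover have "(\<lambda>n. K * (1 + W r) * e (k n)) \<longlonglongrightarrow> 0"
      using tendsto_mult_right_zero [OF e_k] by blast
    ultimately have "(\<lambda>n. delay (e (k n)) (X (k n)) m r - X (k n) m r) \<longlonglongrightarrow> 0"
      by (rule Lim_null_comparison)
    from tendsto_add [OF this x [OF m, of r]] show ?thesis by simp
  qed
  have x_eq: "x j t = z j 0 + integral {0..t} (F x j)" if j: "j \<le> N" and t: "0 \<le> t" for j t
  proof -
    let ?D = "\<lambda>n. delay (e (k n)) (X (k n))"
    have D: "tame (?D n)" for n using tame_delay [OF X] e0 [of "k n"] by simp
    have "(\<lambda>n. integral {0..t} (F (?D n) j)) \<longlonglongrightarrow> integral {0..t} (F x j)"
    proof (rule dominated_convergence(2) [where h = "\<lambda>_. K * (1 + W t)"])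
      show "F (?D n) j integrable_on {0..t}" for n
        using tame_field_integrable D j by simp
      show "norm (F (?D n) j s) \<le> K * (1 + W t)" if "s \<in> {0..t}" for n s
        using tame_field_bound D j that by simp
      show "(\<lambda>n. F (?D n) j s) \<longlonglongrightarrow> F x j s" if s: "s \<in> {0..t}" for s
      proof (rule field_tendsto [where M = "W t"])
        show "norm (?D n m (s - \<sigma>)) \<le> W t" if "m \<le> N" "0 \<le> \<sigma>" for n m \<sigma>
        proof (rule order_trans)
          show "norm (?D n m (s - \<sigma>)) \<le> W (s - \<sigma>)" using D [of n] that(1) unfolding tame_def by blast
          show "W (s - \<sigma>) \<le> W t" using W_mono that(2) s by simp
        qed
        show "continuous_on UNIV (?D n m)" if "m \<le> N" for n m
          using D that unfolding tame_def by blast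
      qed (use s j delayed x_cont in auto)
    qed (auto intro: integrable_const)
    then have "(\<lambda>n. z j 0 + integral {0..t} (F (?D n) j)) \<longlonglongrightarrow> z j 0 + integral {0..t} (F x j)"
      by (intro tendsto_intros)
    moreover have "\<forall>\<^sub>F n in sequentially. z j 0 + integral {0..t} (F (?D n) j) = X (k n) j t"
    proof -
      have "\<forall>\<^sub>F n in sequentially. t \<le> real n"
        using eventually_ge_at_top [of "nat \<lceil>t\<rceil>"] by eventually_elim linarith
      then show ?thesis
      proof eventually_elim
        case (elim n)
        then have "t \<le> real (k n)" using seq_suble [OF k, of n] by linarith
        then show ?case using X_step [OF j, of t "k n"] t by (simp add: step_def)
      qed
    qed
    ultimately have "(\<lambda>n. X (k n) j t) \<longlonglongrightarrow> z j 0 + integral {0..t} (F x j)"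
      by (rule Lim_transform_eventually)
    then show ?thesis using x [OF j] LIMSEQ_unique by blast
  qed
  show thesis using that \<open>tame x\<close> x_init x_eq x_lip by blast
qed

end

text \<open>The integrand is continuous in time, so the equation holds at every positive time.\<close>
lemma (in memory_field) integral_equation_derivative:
  assumes x: "history x" and j: "j \<le> N" and t: "0 < t"
    and eq: "\<And>t. 0 \<le> t \<Longrightarrow> x j t = c + integral {0..t} (F x j)"
  shows "(x j has_vector_derivative F x j t) (at t)"
proof -
  have "continuous_on {0..t + 1} (F x j)"
    using field_continuous [OF x j] by (rule continuous_on_subset) auto
  then have "((\<lambda>u. integral {0..u} (F x j)) has_vector_derivative F x j t) (at t within {0..t + 1})"
    using t by (intro integral_has_vector_derivative) auto
  then have "((\<lambda>u. integral {0..u} (F x j)) has_vector_derivative F x j t) (at t within {0<..<t + 1})"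
    by (rule has_vector_derivative_within_subset) auto
  then have "((\<lambda>u. integral {0..u} (F x j)) has_vector_derivative F x j t) (at t)"
    using t by (subst (asm) at_within_open) auto
  then have "((\<lambda>u. c + integral {0..u} (F x j)) has_vector_derivative F x j t) (at t)"
    by (auto intro!: derivative_eq_intros)
  then show ?thesis
  proof (rule has_vector_derivative_transform_within_open [where S = "{0<..}"])
    show "c + integral {0..u} (F x j) = x j u" if "u \<in> {0<..}" for u using eq [of u] that by simp
  qed (use t in auto)
qed

section \<open>Exponential decay under delayed dissipation\<close>

text \<open>
  A Halanay inequality in several components, proved by a barrier.  Choose \<open>\<mu>\<close> with
  \<open>exp (\<mu> b) - 1 + \<mu> < \<kappa>\<close> and suppose that some \<open>|y i|\<close> touches \<open>w t = C exp (- \<mu> (t - T))\<close>; let \<open>s\<close> be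
  the first such time.  All past values in the window are at most \<open>exp (\<mu> b) w s\<close>, so the
  dissipation hypothesis with \<open>q = exp (\<mu> b)\<close> makes \<open>|y i|\<^sup>2 - w\<^sup>2\<close> strictly decreasing at \<open>s\<close>, although
  it is negative before \<open>s\<close> and zero at \<open>s\<close>.
\<close>
lemma halanay_decay:
  fixes y y' :: "'i \<Rightarrow> real \<Rightarrow> 'a::real_inner"
  assumes I: "finite I" and b: "0 < b" and \<kappa>: "0 < \<kappa>" and C: "0 < C"
    and init: "\<And>i s. i \<in> I \<Longrightarrow> s \<in> {T - b..T} \<Longrightarrow> norm (y i s) < C"
    and cont: "\<And>i. i \<in> I \<Longrightarrow> continuous_on {T..} (y i)"
    and der: "\<And>i t. i \<in> I \<Longrightarrow> T < t \<Longrightarrow> (y i has_vector_derivative y' i t) (at t)"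
    and dissip: "\<And>i t q. \<lbrakk>i \<in> I; T < t; 1 \<le> q; norm (y i t) \<le> C;
        \<And>j \<sigma>. j \<in> I \<Longrightarrow> \<sigma> \<in> {0..b} \<Longrightarrow> norm (y j (t - \<sigma>)) \<le> q * norm (y i t)\<rbrakk>
        \<Longrightarrow> y i t \<bullet> y' i t \<le> (q - 1 - \<kappa>) * (norm (y i t))\<^sup>2"
  obtains \<mu> where "0 < \<mu>" "\<And>i t. i \<in> I \<Longrightarrow> T \<le> t \<Longrightarrow> norm (y i t) < C * exp (- \<mu> * (t - T))"
proof -
  have "((\<lambda>\<mu>. exp (\<mu> * b) - 1 + \<mu>) \<longlongrightarrow> exp (0 * b) - 1 + 0) (at_right 0)"
    by (intro tendsto_intros)
  then have "\<forall>\<^sub>F \<mu> in at_right 0. exp (\<mu> * b) - 1 + \<mu> < \<kappa>"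
    using \<kappa> by (intro order_tendstoD(2)) auto
  moreover have "\<forall>\<^sub>F \<mu> in at_right (0::real). 0 < \<mu>" by (simp add: eventually_at_right_less)
  ultimately have "\<forall>\<^sub>F \<mu> in at_right 0. 0 < \<mu> \<and> exp (\<mu> * b) - 1 + \<mu> < \<kappa>" by eventually_elim simp
  then obtain \<mu> where \<mu>: "0 < \<mu>" "exp (\<mu> * b) - 1 + \<mu> < \<kappa>"
    using eventually_happens' [OF trivial_limit_at_right_real] by blast
  define w where "w t = C * exp (- \<mu> * (t - T))" for t
  have w_pos: "0 < w t" for t using C by (simp add: w_def)
  have w_anti: "w t \<le> w s" if "s \<le> t" for s t using that \<mu> C by (simp add: w_def)
  have w_shift: "w (t - \<sigma>) = exp (\<mu> * \<sigma>) * w t" for t \<sigma>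
    by (simp add: w_def algebra_simps flip: exp_add)
  have w_T: "w T = C" by (simp add: w_def)
  have w_cont: "continuous_on A w" for A unfolding w_def by (intro continuous_intros)
  have "norm (y i t) < w t" if "i \<in> I" "T \<le> t" for i t
  proof (rule ccontr)
    assume "\<not> norm (y i t) < w t"
    define S where "S = (\<Union>i\<in>I. {t \<in> {T..}. w t \<le> norm (y i t)})"
    have "S \<noteq> {}" using that \<open>\<not> norm (y i t) < w t\<close> by (auto simp: S_def not_less)
    moreover have "closed S"
      unfolding S_def
    proof (rule closed_UN [OF I], intro ballI)
      fix i assume "i \<in> I"
      then show "closed {t \<in> {T..}. w t \<le> norm (y i t)}"
        using cont w_cont by (intro continuous_on_closed_Collect_le) (auto intro: continuous_on_norm)
    qed
    moreover have "bdd_below S" by (auto simp: S_def bdd_below_def)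
    ultimately have "Inf S \<in> S" by (simp add: closed_contains_Inf)
    define s where "s = Inf S"
    obtain i where i: "i \<in> I" "T \<le> s" "w s \<le> norm (y i s)" using \<open>Inf S \<in> S\<close> by (auto simp: S_def s_def)
    have below: "norm (y j r) < w r" if "j \<in> I" "T \<le> r" "r < s" for j r
    proof (rule ccontr)
      assume "\<not> norm (y j r) < w r"
      then have "r \<in> S" using that by (auto simp: S_def not_less)
      then have "s \<le> r" unfolding s_def using \<open>bdd_below S\<close> by (rule cInf_lower)
      then show False using that by simp
    qed
    have "T < s" using i init [OF i(1), of T] w_T b by (cases "s = T") auto
    have at_s: "norm (y j s) \<le> w s" if "j \<in> I" for j
    proof -
      have "((\<lambda>r. w r - norm (y j r)) \<longlongrightarrow> w s - norm (y j s)) (at_left s)"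
      proof -
        have "(y j \<longlongrightarrow> y j s) (at s)"
          using has_vector_derivative_continuous [OF der [OF that \<open>T < s\<close>]] by (simp add: continuous_at)
        then have "(y j \<longlongrightarrow> y j s) (at_left s)" by (rule tendsto_mono [rotated]) (simp add: at_le)
        moreover have "(w \<longlongrightarrow> w s) (at_left s)" unfolding w_def by (intro tendsto_intros)
        ultimately show ?thesis by (intro tendsto_intros)
      qed
      moreover have "\<forall>\<^sub>F r in at_left s. 0 \<le> w r - norm (y j r)"
        using eventually_at_left_real [OF \<open>T < s\<close>]
        by eventually_elim (use below [OF that] in \<open>auto intro: less_imp_le\<close>)
      ultimately have "0 \<le> w s - norm (y j s)" by (intro tendsto_lowerbound) auto
      then show ?thesis by simp
    qed
    have touch: "norm (y i s) = w s" using at_s i by force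
    define q where "q = exp (\<mu> * b)"
    have q: "1 \<le> q" using \<mu> b by (simp add: q_def)
    have "y i s \<bullet> y' i s \<le> (q - 1 - \<kappa>) * (norm (y i s))\<^sup>2"
    proof (rule dissip [OF i(1) \<open>T < s\<close> q])
      show "norm (y i s) \<le> C" using touch w_anti [OF i(2)] w_T by simp
      fix j \<sigma> assume j: "j \<in> I" and \<sigma>: "\<sigma> \<in> {0..b}"
      have "norm (y j (s - \<sigma>)) \<le> w (s - \<sigma>)"
      proof (cases "T \<le> s - \<sigma>")
        case True
        then show ?thesis using at_s [OF j] below [OF j, of "s - \<sigma>"] \<sigma> by (cases "\<sigma> = 0") auto
      next
        case False
        then have "norm (y j (s - \<sigma>)) < C" using \<open>T < s\<close> \<sigma> by (intro init j) auto
        then show ?thesis using w_anti [of "s - \<sigma>" T] w_T False by simp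
      qed
      also have "\<dots> \<le> q * norm (y i s)"
        unfolding w_shift touch q_def using \<sigma> \<mu> w_pos [of s] by (intro mult_right_mono) auto
      finally show "norm (y j (s - \<sigma>)) \<le> q * norm (y i s)" .
    qed
    then have "2 * (y i s \<bullet> y' i s) + 2 * \<mu> * (w s)\<^sup>2 \<le> 2 * ((q - 1 - \<kappa> + \<mu>) * (w s)\<^sup>2)"
      by (simp add: touch algebra_simps)
    moreover have "(q - 1 - \<kappa> + \<mu>) * (w s)\<^sup>2 < 0"
      using \<mu> w_pos [of s] by (intro mult_neg_pos) (auto simp: q_def)
    ultimately have neg: "2 * (y i s \<bullet> y' i s) + 2 * \<mu> * (w s)\<^sup>2 < 0" by linarith
    let ?g = "\<lambda>r. y i r \<bullet> y i r - (w r)\<^sup>2"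
    have "(?g has_real_derivative 2 * (y i s \<bullet> y' i s) + 2 * \<mu> * (w s)\<^sup>2) (at s)"
    proof -
      have "((\<lambda>r. y i r \<bullet> y i r) has_vector_derivative y i s \<bullet> y' i s + y' i s \<bullet> y i s) (at s)"
        using der [OF i(1) \<open>T < s\<close>]
        by (intro bounded_bilinear.has_vector_derivative [OF bounded_bilinear_inner])
      then have "((\<lambda>r. y i r \<bullet> y i r) has_real_derivative 2 * (y i s \<bullet> y' i s)) (at s)"
        by (simp add: has_real_derivative_iff_has_vector_derivative inner_commute)
      moreover have "((\<lambda>r. (w r)\<^sup>2) has_real_derivative - (2 * \<mu> * (w s)\<^sup>2)) (at s)"
        unfolding w_def by (auto intro!: derivative_eq_intros simp: power2_eq_square algebra_simps)
      ultimately show ?thesis using DERIV_diff by fastforce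
    qed
    from DERIV_neg_dec_left [OF this neg] obtain d where
      d: "0 < d" "\<And>h. 0 < h \<Longrightarrow> h < d \<Longrightarrow> ?g s < ?g (s - h)" by blast
    define \<rho> where "\<rho> = min d (s - T) / 2"
    have \<rho>: "0 < \<rho>" "\<rho> < d" "T \<le> s - \<rho>" 
      using d(1) \<open>T < s\<close> by (auto simp: \<rho>_def min_def field_simps)
    have "?g s = 0" using touch by (simp add: power2_norm_eq_inner [symmetric])
    moreover have "?g (s - \<rho>) < 0"
      using below [OF i(1) \<rho>(3)] \<rho>(1) power_strict_mono [of "norm (y i (s - \<rho>))" "w (s - \<rho>)" 2]
      by (simp add: power2_norm_eq_inner [symmetric])
    ultimately show False using d(2) [OF \<rho>(1,2)] by simp
  qed
  then show thesis using that [OF \<mu>(1)] by (simp add: w_def)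
qed

section \<open>The velocity field of the agents\<close>

text \<open>
  Both interaction rates are at most \<open>1\<close>; with the normalisation by the window mass \<open>h\<close> this makes the
  velocity of an agent grow at most linearly with the size of the history.
\<close>
locale delayed_consensus =
  fixes N :: nat and \<gamma> \<tau>bar \<tau>star :: real and \<tau> \<beta> a \<phi> :: "real \<Rightarrow> real"
  assumes gamma: "\<gamma> > 0"
    and tau_star: "\<tau>star > 0"
    and tau: "\<And>t. 0 \<le> t \<Longrightarrow> \<tau>star \<le> \<tau> t" "\<And>t. 0 \<le> t \<Longrightarrow> \<tau> t \<le> \<tau>bar"
    and tau_cont: "continuous_on {0..} \<tau>"
    and beta_nonneg: "\<And>s. s \<in> {0..\<tau>bar} \<Longrightarrow> 0 \<le> \<beta> s"
    and beta_int: "set_integrable lebesgue {0..\<tau>bar} \<beta>"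
    and beta_pos: "0 < (LINT s:{0..\<tau>star}|lebesgue. \<beta> s)"
    and a_cont: "continuous_on {0..} a"
    and a_bounds: "\<And>s. 0 \<le> s \<Longrightarrow> 0 \<le> a s" "\<And>s. 0 \<le> s \<Longrightarrow> a s \<le> 1"
    and phi_cont: "continuous_on {0..} \<phi>"
    and phi_bounds: "\<And>s. 0 \<le> s \<Longrightarrow> 0 < \<phi> s" "\<And>s. 0 \<le> s \<Longrightarrow> \<phi> s \<le> 1"
    and phi_mono: "antimono_on {0..} \<phi>"
begin

abbreviation "h \<equiv> delay_mass \<beta> \<tau>"

abbreviation vel :: "(nat \<Rightarrow> real \<Rightarrow> real ^ 'd) \<Rightarrow> nat \<Rightarrow> real \<Rightarrow> real ^ 'd" where
  "vel \<equiv> agent_velocity N \<gamma> \<tau> \<beta> a \<phi>"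

lemma beta_integrable: "c \<le> \<tau>bar \<Longrightarrow> set_integrable lebesgue {0..c} \<beta>"
  by (rule set_integrable_subset [OF beta_int]) auto

lemma delay_mass_pos:
  assumes "0 \<le> t" shows "0 < h t"
proof -
  have "(LINT s:{0..\<tau>star}|lebesgue. \<beta> s) \<le> h t"
    unfolding delay_mass_def set_lebesgue_integral_def
  proof (rule integral_mono)
    show "integrable lebesgue (\<lambda>s. indicat_real {0..\<tau>star} s *\<^sub>R \<beta> s)"
      "integrable lebesgue (\<lambda>s. indicat_real {0..\<tau> t} s *\<^sub>R \<beta> s)"
      using beta_integrable tau [OF assms] by (auto simp: set_integrable_def)
    show "indicat_real {0..\<tau>star} s *\<^sub>R \<beta> s \<le> indicat_real {0..\<tau> t} s *\<^sub>R \<beta> s" for s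
      using beta_nonneg [of s] tau [OF assms] by (auto simp: indicator_def)
  qed
  then show ?thesis using beta_pos by simp
qed

definition kernel :: "(real \<Rightarrow> real) \<Rightarrow> real ^ 'd \<Rightarrow> real ^ 'd" where
  "kernel w v = w (norm v) *\<^sub>R v"

lemma kernel_continuous:
  assumes "continuous_on {0..} w" shows "continuous_on UNIV (kernel w)"
proof -
  have "continuous_on UNIV (\<lambda>v::real ^ 'd. w (norm v))"
    by (rule continuous_on_compose2 [OF assms continuous_on_norm_id]) auto
  then show ?thesis unfolding kernel_def by (intro continuous_on_scaleR continuous_on_id)
qed

lemma norm_kernel_le:
  assumes "\<And>s. 0 \<le> s \<Longrightarrow> 0 \<le> w s" "\<And>s. 0 \<le> s \<Longrightarrow> w s \<le> 1"
  shows "norm (kernel w v) \<le> norm v"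
  using mult_right_mono [OF assms(2) [OF norm_ge_zero], of "norm v" v] assms(1) [of "norm v"]
  by (simp add: kernel_def)

text \<open>
  In the variable \<open>\<sigma> = t - s\<close>, the age of the information, the time \<open>t\<close> enters through the histories and the
  length of the window while the weight stays fixed; this is the form to which dominated
  convergence applies.
\<close>
lemma agent_velocity_reflected:
  "vel y i t = (1 / (real N * h t)) *\<^sub>R
       (\<Sum>j\<in>{1..N} - {i}. LINT \<sigma>:{0..\<tau> t}|lebesgue. \<beta> \<sigma> *\<^sub>R kernel a (y j (t - \<sigma>) - y i t))
     + (\<gamma> / h t) *\<^sub>R (LINT \<sigma>:{0..\<tau> t}|lebesgue. \<beta> \<sigma> *\<^sub>R kernel \<phi> (y 0 (t - \<sigma>) - y i t))"
  unfolding agent_velocity_def by (subst (1 2) set_integral_reflect_window) (simp add: kernel_def)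

lemma agent_velocity_translate: "vel (\<lambda>j s. y j s - c) i t = vel y i t"
  by (simp add: agent_velocity_def)

lemma agent_velocity_cong:
  assumes "0 \<le> t" "i \<le> N" "\<And>j s. j \<le> N \<Longrightarrow> t - \<tau>bar \<le> s \<Longrightarrow> y j s = y' j s"
  shows "vel y i t = vel y' i t"
proof -
  have "y i t = y' i t" using assms tau [OF assms(1)] tau_star by auto
  moreover have "(LINT \<sigma>:{0..\<tau> t}|lebesgue. \<beta> \<sigma> *\<^sub>R kernel w (y j (t - \<sigma>) - y i t))
      = (LINT \<sigma>:{0..\<tau> t}|lebesgue. \<beta> \<sigma> *\<^sub>R kernel w (y' j (t - \<sigma>) - y' i t))" if "j \<le> N" for j w
    using assms tau [OF assms(1)] \<open>y i t = y' i t\<close> that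
    by (intro set_lebesgue_integral_cong) auto
  ultimately show ?thesis
    by (auto simp: agent_velocity_reflected intro!: sum.cong arg_cong2 [of _ _ _ _ "(+)"] arg_cong [of _ _ "(*\<^sub>R) _"])
qed

lemma agent_velocity_bound:
  assumes "0 \<le> t" "i \<in> {1..N}" and M: "\<And>j s. j \<le> N \<Longrightarrow> s \<le> t \<Longrightarrow> norm (y j s) \<le> M"
  shows "norm (vel y i t) \<le> 2 * (1 + \<gamma>) * M"
proof -
  have "0 \<le> M" using M [of 0 t] norm_ge_zero [of "y 0 t"] by linarith
  have h: "0 < h t" using delay_mass_pos assms by simp
  have I: "norm (LINT \<sigma>:{0..\<tau> t}|lebesgue. \<beta> \<sigma> *\<^sub>R kernel w (y j (t - \<sigma>) - y i t)) \<le> 2 * M * h t"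
    if "j \<le> N" and w: "\<And>s. 0 \<le> s \<Longrightarrow> 0 \<le> w s" "\<And>s. 0 \<le> s \<Longrightarrow> w s \<le> 1" for j w
    unfolding delay_mass_def
  proof (rule norm_set_integral_scaleR_le)
    show "set_integrable lebesgue {0..\<tau> t} \<beta>" using beta_integrable tau assms by simp
    show "0 \<le> \<beta> \<sigma>" if "\<sigma> \<in> {0..\<tau> t}" for \<sigma>
      using beta_nonneg [of \<sigma>] that tau(2) [OF assms(1)] by simp
    show "norm (kernel w (y j (t - \<sigma>) - y i t)) \<le> 2 * M" if "\<sigma> \<in> {0..\<tau> t}" for \<sigma>
    proof -
      have "norm (y j (t - \<sigma>)) \<le> M" "norm (y i t) \<le> M" using M that \<open>j \<le> N\<close> assms(2) by auto
      then show ?thesis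
        using norm_kernel_le [of w "y j (t - \<sigma>) - y i t", OF w]
          norm_triangle_ineq4 [of "y j (t - \<sigma>)" "y i t"] by linarith
    qed
  qed (use \<open>0 \<le> M\<close> in simp)
  let ?S = "\<Sum>j\<in>{1..N} - {i}. LINT \<sigma>:{0..\<tau> t}|lebesgue. \<beta> \<sigma> *\<^sub>R kernel a (y j (t - \<sigma>) - y i t)"
  have "norm ?S \<le> (\<Sum>j\<in>{1..N} - {i}. 2 * M * h t)"
    by (rule sum_norm_le) (use I a_bounds in auto)
  also have "\<dots> \<le> N * (2 * M * h t)"
    using assms(2) \<open>0 \<le> M\<close> h by (auto simp: card_Diff_singleton intro!: mult_right_mono)
  finally have 1: "norm ((1 / (real N * h t)) *\<^sub>R ?S) \<le> 2 * M"
    using h assms(2) by (simp add: divide_simps mult_ac)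
  have 2: "norm ((\<gamma> / h t) *\<^sub>R (LINT \<sigma>:{0..\<tau> t}|lebesgue. \<beta> \<sigma> *\<^sub>R kernel \<phi> (y 0 (t - \<sigma>) - y i t))) \<le> \<gamma> * (2 * M)"
    using I [of 0 \<phi>] phi_bounds h gamma by (simp add: divide_simps mult_ac less_imp_le)
  show ?thesis
    unfolding agent_velocity_reflected using norm_triangle_le [OF add_mono [OF 1 2]]
    by (simp add: algebra_simps)
qed

lemma kernel_window_measurable:
  assumes w: "continuous_on {0..} w" and z: "continuous_on UNIV z"
  shows "(\<lambda>\<sigma>. kernel w (z (s - \<sigma>) - v)) \<in> borel_measurable lebesgue"
proof -
  have "continuous_on UNIV (\<lambda>\<sigma>. z (s - \<sigma>))"
    by (rule continuous_on_compose2 [OF z]) (auto intro!: continuous_intros)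
  then have "continuous_on UNIV (\<lambda>\<sigma>. z (s - \<sigma>) - v)" by (intro continuous_intros)
  then have "continuous_on UNIV (\<lambda>\<sigma>. kernel w (z (s - \<sigma>) - v))"
    by (rule continuous_on_compose2 [OF kernel_continuous [OF w]]) auto
  then show ?thesis
    by (intro measurable_completion) (simp add: borel_measurable_continuous_onI)
qed

lemma agent_velocity_tendsto:
  assumes t: "t \<longlonglongrightarrow> t0" "\<And>n. 0 \<le> t n" "0 \<le> t0" and i: "i \<in> {1..N}"
    and cont: "\<And>n j. j \<le> N \<Longrightarrow> continuous_on UNIV (y n j)" "\<And>j. j \<le> N \<Longrightarrow> continuous_on UNIV (y0 j)"
    and M: "\<And>n j \<sigma>. j \<le> N \<Longrightarrow> 0 \<le> \<sigma> \<Longrightarrow> norm (y n j (t n - \<sigma>)) \<le> M"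
    and lim: "\<And>j \<sigma>. j \<le> N \<Longrightarrow> 0 \<le> \<sigma> \<Longrightarrow> (\<lambda>n. y n j (t n - \<sigma>)) \<longlonglongrightarrow> y0 j (t0 - \<sigma>)"
  shows "(\<lambda>n. vel (y n) i (t n)) \<longlonglongrightarrow> vel y0 i t0"
proof -
  have tau_lim: "(\<lambda>n. \<tau> (t n)) \<longlonglongrightarrow> \<tau> t0"
    using continuous_on_tendsto_compose [OF tau_cont t(1)] t by simp
  have "(\<lambda>n. LINT \<sigma>:{0..\<tau> (t n)}|lebesgue. \<beta> \<sigma> *\<^sub>R (1::real))
      \<longlonglongrightarrow> (LINT \<sigma>:{0..\<tau> t0}|lebesgue. \<beta> \<sigma> *\<^sub>R (1::real))"
    by (rule window_integral_tendsto [OF beta_int tau_lim, of _ _ 1]) (use tau t in auto)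
  then have h: "(\<lambda>n. h (t n)) \<longlonglongrightarrow> h t0" by (simp add: delay_mass_def)
  have h0: "h t0 \<noteq> 0" using delay_mass_pos [OF t(3)] by simp
  have W: "(\<lambda>n. LINT \<sigma>:{0..\<tau> (t n)}|lebesgue. \<beta> \<sigma> *\<^sub>R kernel w (y n j (t n - \<sigma>) - y n i (t n)))
      \<longlonglongrightarrow> (LINT \<sigma>:{0..\<tau> t0}|lebesgue. \<beta> \<sigma> *\<^sub>R kernel w (y0 j (t0 - \<sigma>) - y0 i t0))"
    if "j \<le> N" and w: "continuous_on {0..} w" "\<And>s. 0 \<le> s \<Longrightarrow> 0 \<le> w s" "\<And>s. 0 \<le> s \<Longrightarrow> w s \<le> 1" for j w
  proof (rule window_integral_tendsto [OF beta_int tau_lim])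
    have k: "continuous_on UNIV (kernel w)" using kernel_continuous w(1) .
    show "(\<lambda>\<sigma>. kernel w (y n j (t n - \<sigma>) - y n i (t n))) \<in> borel_measurable lebesgue" for n
      using kernel_window_measurable [OF w(1)] cont \<open>j \<le> N\<close> by blast
    show "(\<lambda>\<sigma>. kernel w (y0 j (t0 - \<sigma>) - y0 i t0)) \<in> borel_measurable lebesgue"
      using kernel_window_measurable [OF w(1)] cont \<open>j \<le> N\<close> by blast
    have iN: "i \<le> N" using i by simp
    show "norm (kernel w (y n j (t n - \<sigma>) - y n i (t n))) \<le> 2 * M" if "\<sigma> \<in> {0..\<tau>bar}" for n \<sigma>
    proof -
      have "norm (y n j (t n - \<sigma>)) \<le> M" "norm (y n i (t n)) \<le> M"
        using M [OF \<open>j \<le> N\<close>, of \<sigma> n] M [OF iN, of 0 n] that by auto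
      then show ?thesis
        using norm_kernel_le [of w "y n j (t n - \<sigma>) - y n i (t n)", OF w(2,3)]
          norm_triangle_ineq4 [of "y n j (t n - \<sigma>)" "y n i (t n)"] by linarith
    qed
    show "(\<lambda>n. kernel w (y n j (t n - \<sigma>) - y n i (t n))) \<longlonglongrightarrow> kernel w (y0 j (t0 - \<sigma>) - y0 i t0)"
      if "\<sigma> \<in> {0..\<tau>bar}" for \<sigma>
      using lim [OF \<open>j \<le> N\<close>, of \<sigma>] lim [OF iN, of 0] that
      by (intro continuous_on_tendsto_compose [OF k] tendsto_diff) auto
  qed (use tau t in auto)
  show ?thesis
    unfolding agent_velocity_reflected using i h0
    by (intro tendsto_intros h W) (auto simp: a_cont a_bounds phi_cont phi_bounds less_imp_le)
qed

text \<open>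
  The balance that drives the convergence, with the target placed at the origin.  For another agent at
  past position \<open>z\<close> with \<open>|z| \<le> q |v|\<close>, Cauchy--Schwarz gives \<open>v \<bullet> (z - v) \<le> (q - 1) |v|\<^sup>2\<close>; multiplying by a
  weight in \<open>[0, 1]\<close> preserves this bound since \<open>q \<ge> 1\<close>.  The leader sits at the target and
  contributes \<open>- \<gamma> \<phi>(|v|) |v|\<^sup>2\<close>.
\<close>
lemma agent_velocity_inner_le:
  assumes t: "0 \<le> t" and i: "i \<in> {1..N}" and q: "1 \<le> q"
    and cont: "\<And>j. j \<le> N \<Longrightarrow> continuous_on UNIV (y j)"
    and leader: "\<And>\<sigma>. \<sigma> \<in> {0..\<tau>bar} \<Longrightarrow> y 0 (t - \<sigma>) = 0"
    and agents: "\<And>j \<sigma>. j \<in> {1..N} \<Longrightarrow> \<sigma> \<in> {0..\<tau>bar} \<Longrightarrow> norm (y j (t - \<sigma>)) \<le> q * norm (y i t)"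
  shows "y i t \<bullet> vel y i t \<le> (q - 1 - \<gamma> * \<phi> (norm (y i t))) * (norm (y i t))\<^sup>2"
proof -
  define v where "v = y i t"
  have h: "0 < h t" using delay_mass_pos t .
  have win: "\<sigma> \<in> {0..\<tau>bar}" if "\<sigma> \<in> {0..\<tau> t}" for \<sigma> using that tau(2) [OF t] by auto
  have bint: "set_integrable lebesgue {0..\<tau> t} \<beta>" using beta_integrable tau t by simp
  have bnn: "0 \<le> \<beta> \<sigma>" if "\<sigma> \<in> {0..\<tau> t}" for \<sigma> using beta_nonneg win [OF that] .
  let ?I = "\<lambda>w j. LINT \<sigma>:{0..\<tau> t}|lebesgue. \<beta> \<sigma> *\<^sub>R kernel w (y j (t - \<sigma>) - v)"
  have agent: "v \<bullet> ?I a j \<le> (q - 1) * (norm v)\<^sup>2 * h t" if j: "j \<in> {1..N}" for j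
    unfolding delay_mass_def
  proof (rule inner_set_integral_scaleR_le [OF bint bnn])
    have "j \<le> N" using j by simp
    then show "(\<lambda>\<sigma>. kernel a (y j (t - \<sigma>) - v)) \<in> borel_measurable lebesgue"
      using kernel_window_measurable a_cont cont by blast
    fix \<sigma> assume \<sigma>: "\<sigma> \<in> {0..\<tau> t}"
    let ?d = "y j (t - \<sigma>) - v"
    have y: "norm (y j (t - \<sigma>)) \<le> q * norm v" using agents [OF j win [OF \<sigma>]] by (simp add: v_def)
    show "norm (kernel a ?d) \<le> q * norm v + norm v"
      using norm_kernel_le [of a ?d, OF a_bounds] norm_triangle_ineq4 [of "y j (t - \<sigma>)" v] y by linarith
    have "v \<bullet> y j (t - \<sigma>) \<le> norm v * (q * norm v)"
      using norm_cauchy_schwarz [of v "y j (t - \<sigma>)"] mult_left_mono [OF y norm_ge_zero [of v]] by linarith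
    then have "v \<bullet> ?d \<le> (q - 1) * (norm v)\<^sup>2"
      by (simp add: inner_diff_right power2_norm_eq_inner [symmetric] power2_eq_square algebra_simps)
    then have "a (norm ?d) * (v \<bullet> ?d) \<le> a (norm ?d) * ((q - 1) * (norm v)\<^sup>2)"
      using a_bounds(1) [of "norm ?d"] by (intro mult_left_mono) auto
    also have "\<dots> \<le> 1 * ((q - 1) * (norm v)\<^sup>2)"
      using a_bounds(2) [of "norm ?d"] q by (intro mult_right_mono) auto
    finally show "v \<bullet> kernel a ?d \<le> (q - 1) * (norm v)\<^sup>2" by (simp add: kernel_def)
  qed
  have "v \<bullet> ?I \<phi> 0 \<le> - (\<phi> (norm v) * (norm v)\<^sup>2) * h t"
    unfolding delay_mass_def
  proof (rule inner_set_integral_scaleR_le [OF bint bnn])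
    show "(\<lambda>\<sigma>. kernel \<phi> (y 0 (t - \<sigma>) - v)) \<in> borel_measurable lebesgue"
      using kernel_window_measurable phi_cont cont by blast
    fix \<sigma> assume \<sigma>: "\<sigma> \<in> {0..\<tau> t}"
    have y0: "y 0 (t - \<sigma>) - v = - v" using leader [OF win [OF \<sigma>]] by simp
    show "norm (kernel \<phi> (y 0 (t - \<sigma>) - v)) \<le> norm v"
      unfolding y0 using norm_kernel_le [of \<phi> "- v"] phi_bounds by (simp add: less_imp_le)
    show "v \<bullet> kernel \<phi> (y 0 (t - \<sigma>) - v) \<le> - (\<phi> (norm v) * (norm v)\<^sup>2)"
      unfolding y0 by (simp add: kernel_def power2_norm_eq_inner)
  qed
  then have lead: "\<gamma> / h t * (v \<bullet> ?I \<phi> 0) \<le> - \<gamma> * \<phi> (norm v) * (norm v)\<^sup>2"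
    using h gamma mult_left_mono [of "v \<bullet> ?I \<phi> 0" "- (\<phi> (norm v) * (norm v)\<^sup>2) * h t" "\<gamma> / h t"]
    by (simp add: field_simps)
  have "(\<Sum>j\<in>{1..N} - {i}. v \<bullet> ?I a j) \<le> (\<Sum>j\<in>{1..N} - {i}. (q - 1) * (norm v)\<^sup>2 * h t)"
    using agent by (intro sum_mono) auto
  also have "\<dots> \<le> N * ((q - 1) * (norm v)\<^sup>2 * h t)"
    using i q h by (auto simp: card_Diff_singleton intro!: mult_right_mono)
  finally have "1 / (N * h t) * (\<Sum>j\<in>{1..N} - {i}. v \<bullet> ?I a j)
      \<le> 1 / (N * h t) * (N * ((q - 1) * (norm v)\<^sup>2 * h t))"
    using h by (intro mult_left_mono) auto
  also have "\<dots> = (q - 1) * (norm v)\<^sup>2" using h i by simp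
  finally have "1 / (N * h t) * (\<Sum>j\<in>{1..N} - {i}. v \<bullet> ?I a j) \<le> (q - 1) * (norm v)\<^sup>2" .
  moreover have "v \<bullet> vel y i t = 1 / (N * h t) * (\<Sum>j\<in>{1..N} - {i}. v \<bullet> ?I a j) + \<gamma> / h t * (v \<bullet> ?I \<phi> 0)"
    unfolding agent_velocity_reflected v_def [symmetric]
    by (simp only: inner_add_right inner_scaleR_right inner_sum_right)
  ultimately show ?thesis using lead unfolding v_def [symmetric] by (simp add: algebra_simps)
qed

text \<open>Leader and agents as one field, so that the general existence theorem covers the whole system.\<close>
definition drift :: "(real \<Rightarrow> real ^ 'd) \<Rightarrow> (nat \<Rightarrow> real \<Rightarrow> real ^ 'd) \<Rightarrow> nat \<Rightarrow> real \<Rightarrow> real ^ 'd" where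
  "drift u y i t = (if i = 0 then u t else vel y i t)"

lemma memory_field_drift:
  assumes u: "continuous_on UNIV u" and U: "\<And>t. 0 \<le> t \<Longrightarrow> norm (u t) \<le> U"
  shows "memory_field N (2 * (1 + \<gamma>) + U) (drift u)"
proof
  have U0: "0 \<le> U" using U [of 0] norm_ge_zero [of "u 0"] by linarith
  then show "0 < 2 * (1 + \<gamma>) + U" using gamma by simp
  show "norm (drift u y j t) \<le> (2 * (1 + \<gamma>) + U) * (1 + M)"
    if tj: "0 \<le> t" "j \<le> N" and M: "\<And>m s. m \<le> N \<Longrightarrow> s \<le> t \<Longrightarrow> norm (y m s) \<le> M" for y j t M
  proof -
    have M0: "0 \<le> M" using M [of 0 t] norm_ge_zero [of "y 0 t"] by linarith
    have "norm (drift u y j t) \<le> 2 * (1 + \<gamma>) * M + U"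
    proof (cases "j = 0")
      case True
      then show ?thesis using U [OF tj(1)] gamma M0 by (simp add: drift_def add_increasing)
    next
      case False
      then show ?thesis using agent_velocity_bound [of t j y M] tj M U0 by (simp add: drift_def)
    qed
    also have "\<dots> \<le> (2 * (1 + \<gamma>) + U) * (1 + M)"
      using gamma U0 M0 by (simp add: algebra_simps)
    finally show ?thesis .
  qed
  show "(\<lambda>n. drift u (y n) j (t n)) \<longlonglongrightarrow> drift u y0 j t0"
    if "t \<longlonglongrightarrow> t0" "\<And>n. 0 \<le> t n" "0 \<le> t0" "j \<le> N"
      "\<And>n m. m \<le> N \<Longrightarrow> continuous_on UNIV (y n m)" "\<And>m. m \<le> N \<Longrightarrow> continuous_on UNIV (y0 m)"
      "\<And>n m \<sigma>. m \<le> N \<Longrightarrow> 0 \<le> \<sigma> \<Longrightarrow> norm (y n m (t n - \<sigma>)) \<le> M"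
      "\<And>m \<sigma>. m \<le> N \<Longrightarrow> 0 \<le> \<sigma> \<Longrightarrow> (\<lambda>n. y n m (t n - \<sigma>)) \<longlonglongrightarrow> y0 m (t0 - \<sigma>)"
    for t t0 y y0 j M
  proof (cases "j = 0")
    case True
    then show ?thesis
      using continuous_on_tendsto_compose [OF u that(1)] by (simp add: drift_def)
  next
    case False
    have "(\<lambda>n. vel (y n) j (t n)) \<longlonglongrightarrow> vel y0 j t0"
      by (rule agent_velocity_tendsto [OF that(1-3) _ that(5-8)]) (use False \<open>j \<le> N\<close> in auto)
    then show ?thesis using False by (simp add: drift_def)
  qed
qed

subsection \<open>Solutions of the controlled system\<close>

lemma tau_bar_pos: "0 < \<tau>bar"
  using tau [of 0] tau_star by simp

lemma is_solution_exists:
  fixes xin :: "nat \<Rightarrow> real \<Rightarrow> real ^ 'd"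
  assumes u: "continuous_on UNIV u" and U: "\<And>t. 0 \<le> t \<Longrightarrow> norm (u t) \<le> U"
    and xin: "\<And>i. i \<le> N \<Longrightarrow> continuous_on {-\<tau>bar..0} (xin i)"
  shows "\<exists>x. is_solution N \<gamma> \<tau>bar \<tau> \<beta> a \<phi> xin u x"
proof -
  define z where "z i s = xin i (max (-\<tau>bar) (min s 0))" for i s
  have "bounded (\<Union>i\<in>{..N}. xin i ` {-\<tau>bar..0})"
    by (intro bounded_UN) (auto intro!: compact_imp_bounded compact_continuous_image xin)
  then obtain R where R: "\<And>i s. i \<le> N \<Longrightarrow> s \<in> {-\<tau>bar..0} \<Longrightarrow> norm (xin i s) \<le> R"
    unfolding bounded_iff by fastforce
  interpret D: memory_field N "2 * (1 + \<gamma>) + U" "drift u"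
    using memory_field_drift u U .
  interpret D: memory_ivp N "2 * (1 + \<gamma>) + U" "drift u" z R
  proof
    fix i assume i: "i \<le> N"
    have "continuous_on UNIV (\<lambda>s. xin i (max (-\<tau>bar) (min s 0)))"
      by (rule continuous_on_compose2 [OF xin [OF i]]) (use tau_bar_pos in \<open>auto intro!: continuous_intros\<close>)
    then show "continuous_on UNIV (z i)" by (simp add: z_def [abs_def])
    show "norm (z i s) \<le> R" for s unfolding z_def using tau_bar_pos by (intro R i) auto
  qed
  obtain x where x: "D.tame x" and x_init: "\<And>j s. j \<le> N \<Longrightarrow> s \<le> 0 \<Longrightarrow> x j s = z j s"
    and x_eq: "\<And>j t. j \<le> N \<Longrightarrow> 0 \<le> t \<Longrightarrow> x j t = z j 0 + integral {0..t} (drift u x j)"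
    and x_lip: "\<And>j S s t. \<lbrakk>j \<le> N; 0 \<le> s; s \<le> t; t \<le> S\<rbrakk>
        \<Longrightarrow> norm (x j t - x j s) \<le> (2 * (1 + \<gamma>) + U) * (1 + D.W S) * (t - s)"
    by (rule D.solution_exists) blast
  have der: "(x j has_vector_derivative drift u x j t) (at t)" if "j \<le> N" "0 < t" for j t
    by (rule D.integral_equation_derivative [OF D.tame_history [OF x] that x_eq [OF that(1)]])
  have null: "AE t in lebesgue. t \<noteq> (0::real)"
    by (rule AE_I' [of "{0}"]) (auto simp flip: negligible_iff_null_sets)
  have "is_solution N \<gamma> \<tau>bar \<tau> \<beta> a \<phi> xin u x"
    unfolding is_solution_def
  proof (intro conjI allI impI ballI)
    fix i assume i: "i \<le> N"
    show "continuous_on {-\<tau>bar..} (x i)"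
      using x i unfolding D.tame_def by (meson continuous_on_subset subset_UNIV)
    show "locally_abs_continuous (x i)"
      unfolding locally_abs_continuous_def
      using x_lip [OF i] by (blast intro: lipschitz_imp_abs_continuous_on)
    fix s assume "s \<in> {-\<tau>bar..0}"
    then show "x i s = xin i s" using x_init [OF i, of s] by (simp add: z_def)
  next
    show "AE t in lebesgue. 0 \<le> t \<longrightarrow> (x 0 has_vector_derivative u t) (at t)"
      using null by eventually_elim (use der [of 0] in \<open>auto simp: drift_def\<close>)
    fix i assume "i \<in> {1..N}"
    then have d: "(x i has_vector_derivative vel x i t) (at t)" if "0 < t" for t
      using der [of i t] that by (simp add: drift_def)
    show "AE t in lebesgue. 0 \<le> t \<longrightarrow> (x i has_vector_derivative vel x i t) (at t)"
      using null by eventually_elim (simp add: d)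
  qed
  then show ?thesis by blast
qed

text \<open>
  A solution may be arbitrary before \<open>-\<tau>bar\<close>; freezing it there yields a globally continuous history
  with the same velocities at nonnegative times.
\<close>
lemma is_solution_integral_equation:
  fixes x :: "nat \<Rightarrow> real \<Rightarrow> real ^ 'd"
  assumes u: "continuous_on UNIV u" and U: "\<And>t. 0 \<le> t \<Longrightarrow> norm (u t) \<le> U"
    and sol: "is_solution N \<gamma> \<tau>bar \<tau> \<beta> a \<phi> xin u x"
  defines "y \<equiv> \<lambda>i s. x i (max s (-\<tau>bar))"
  shows "memory_field.history N y"
    and "\<And>i t. i \<le> N \<Longrightarrow> 0 \<le> t \<Longrightarrow> y i t = xin i 0 + integral {0..t} (drift u y i)"
proof -
  interpret D: memory_field N "2 * (1 + \<gamma>) + U" "drift u"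
    using memory_field_drift u U .
  have x_cont: "continuous_on {-\<tau>bar..} (x i)" if "i \<le> N" for i
    using sol that by (simp add: is_solution_def)
  have y_cont: "continuous_on UNIV (y i)" if "i \<le> N" for i
    unfolding y_def by (rule continuous_on_compose2 [OF x_cont [OF that]]) (auto intro!: continuous_intros)
  have "\<exists>M. \<forall>i\<le>N. \<forall>s\<le>T. norm (y i s) \<le> M" for T
  proof -
    have "bounded (\<Union>i\<in>{..N}. x i ` {-\<tau>bar..max T (-\<tau>bar)})"
      by (intro bounded_UN ballI compact_imp_bounded compact_continuous_image continuous_on_subset [OF x_cont]) auto
    then obtain M where "\<And>i s. i \<le> N \<Longrightarrow> s \<in> {-\<tau>bar..max T (-\<tau>bar)} \<Longrightarrow> norm (x i s) \<le> M"
      unfolding bounded_iff by fastforce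
    then have "norm (y i s) \<le> M" if "i \<le> N" "s \<le> T" for i s
      using that by (simp add: y_def)
    then show ?thesis by blast
  qed
  then show "D.history y" unfolding D.history_def using y_cont by blast
  fix i and t :: real assume i: "i \<le> N" and t: "0 \<le> t"
  have same: "y j s = x j s" if "-\<tau>bar \<le> s" for j s using that by (simp add: y_def max_absorb1)
  have x0: "x i 0 = xin i 0" using sol i tau_bar_pos by (simp add: is_solution_def)
  have drift: "drift u y i s = (if i = 0 then u s else vel x i s)" if "0 \<le> s" for s
    using agent_velocity_cong [OF that i, of y x] same that by (simp add: drift_def)
  have ae: "AE s in lebesgue. 0 \<le> s \<longrightarrow> (x i has_vector_derivative (if i = 0 then u s else vel x i s)) (at s)"
  proof (cases "i = 0")
    case True
    then show ?thesis using sol by (simp add: is_solution_def)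
  next
    case False
    then have "i \<in> {1..N}" using i by simp
    then show ?thesis using sol False by (simp add: is_solution_def)
  qed
  then obtain E where E: "E \<in> null_sets lebesgue"
    and dE: "{s. \<not> (0 \<le> s \<longrightarrow> (x i has_vector_derivative (if i = 0 then u s else vel x i s)) (at s))} \<subseteq> E"
    unfolding eventually_ae_filter by auto
  have "(drift u y i has_integral x i t - x i 0) {0..t}"
  proof (rule ftc_abs_continuous [OF t _ _])
    show "abs_continuous_on 0 t (x i)"
    proof (cases "t = 0")
      case True
      show ?thesis
      proof (rule lipschitz_imp_abs_continuous_on)
        fix s r assume "0 \<le> s" "s \<le> r" "r \<le> t"
        then have "r = s" using True by linarith
        then show "norm (x i r - x i s) \<le> 0 * (r - s)" by simp
      qed
    next
      case False
      then show ?thesis using sol i t by (simp add: is_solution_def locally_abs_continuous_def)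
    qed
    show "negligible E" using E by (simp add: negligible_iff_null_sets)
    fix s assume s: "s \<in> {0..t} - E"
    then have "(x i has_vector_derivative drift u y i s) (at s)"
      using dE drift [of s] by auto
    then show "(x i has_vector_derivative drift u y i s) (at s within {0..t})"
      by (rule has_vector_derivative_at_within)
  qed
  then show "y i t = xin i 0 + integral {0..t} (drift u y i)"
    using same [of t i] t tau_bar_pos x0 by (simp add: integral_unique)
qed

text \<open>
  At times beyond \<open>S + \<tau>bar\<close> the agents see the leader at \<open>xbar\<close> only.  The constant \<open>C\<close> exceeds all
  distances to \<open>xbar\<close> up to that time, and the barrier argument runs with dissipation rate \<open>\<gamma> \<phi>(C)\<close>.
\<close>
lemma consensus_after_leader_stops:
  fixes x :: "nat \<Rightarrow> real \<Rightarrow> real ^ 'd"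
  assumes u: "continuous_on UNIV u" and U: "\<And>t. 0 \<le> t \<Longrightarrow> norm (u t) \<le> U"
    and reach: "\<And>t. S \<le> t \<Longrightarrow> xin 0 0 + integral {0..t} u = xbar" and S: "0 \<le> S"
    and sol: "is_solution N \<gamma> \<tau>bar \<tau> \<beta> a \<phi> xin u x" and i: "i \<le> N"
  shows "(x i \<longlongrightarrow> xbar) at_top"
proof -
  interpret D: memory_field N "2 * (1 + \<gamma>) + U" "drift u"
    using memory_field_drift u U .
  define y where "y = (\<lambda>i s. x i (max s (-\<tau>bar)))"
  have y: "D.history y" and y_eq: "\<And>i t. i \<le> N \<Longrightarrow> 0 \<le> t \<Longrightarrow> y i t = xin i 0 + integral {0..t} (drift u y i)"
    unfolding y_def using is_solution_integral_equation [OF u U sol] by blast+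
  have y_cont: "continuous_on A (y i)" if "i \<le> N" for i A
    using y that unfolding D.history_def by (meson continuous_on_subset subset_UNIV)
  have y_der: "(y i has_vector_derivative drift u y i t) (at t)" if "i \<le> N" "0 < t" for i t
    by (rule D.integral_equation_derivative [OF y that y_eq [OF that(1)]])
  have leader: "y 0 t = xbar" if "S \<le> t" for t
  proof -
    have "drift u y 0 = u" by (auto simp: drift_def)
    then show ?thesis using y_eq [of 0 t] reach [OF that] S that by simp
  qed
  define v where "v = (\<lambda>i s. y i s - xbar)"
  have v_cont: "continuous_on A (v i)" if "i \<le> N" for i A
    unfolding v_def using y_cont [OF that] by (intro continuous_intros)
  obtain M where M: "\<And>i s. i \<le> N \<Longrightarrow> s \<le> S + \<tau>bar \<Longrightarrow> norm (y i s) \<le> M"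
    using y unfolding D.history_def by metis
  define C where "C = M + norm xbar + 1"
  have "norm (y 0 0) \<le> M" using M S tau_bar_pos by simp
  then have M0: "0 \<le> M" using norm_ge_zero order_trans by blast
  have C: "0 < C" using M0 by (simp add: C_def add_nonneg_pos)
  have "\<exists>\<mu>>0. \<forall>i\<in>{1..N}. \<forall>t\<ge>S + \<tau>bar. norm (v i t) < C * exp (- \<mu> * (t - (S + \<tau>bar)))"
  proof (rule halanay_decay [where I = "{1..N}" and b = \<tau>bar and \<kappa> = "\<gamma> * \<phi> C" and C = C
        and T = "S + \<tau>bar" and y = v and y' = "vel y"])
    show "\<exists>\<mu>>0. \<forall>i\<in>{1..N}. \<forall>t\<ge>S + \<tau>bar. norm (v i t) < C * exp (- \<mu> * (t - (S + \<tau>bar)))"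
      if "0 < \<mu>" "\<And>i t. i \<in> {1..N} \<Longrightarrow> S + \<tau>bar \<le> t \<Longrightarrow> norm (v i t) < C * exp (- \<mu> * (t - (S + \<tau>bar)))" for \<mu>
      using that by blast
    show "0 < \<gamma> * \<phi> C" using gamma phi_bounds(1) [of C] C by simp
    show "norm (v i s) < C" if "i \<in> {1..N}" "s \<in> {S + \<tau>bar - \<tau>bar..S + \<tau>bar}" for i s
      using M [of i s] that norm_triangle_ineq4 [of "y i s" xbar] by (simp add: v_def C_def)
    show "(v i has_vector_derivative vel y i t) (at t)" if "i \<in> {1..N}" "S + \<tau>bar < t" for i t
    proof -
      have "0 < t" using that(2) S tau_bar_pos by simp
      then have "(y i has_vector_derivative vel y i t) (at t)"
        using y_der [of i t] that by (simp add: drift_def)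
      then show ?thesis unfolding v_def by (auto intro!: derivative_eq_intros)
    qed
    show "v i t \<bullet> vel y i t \<le> (q - 1 - \<gamma> * \<phi> C) * (norm (v i t))\<^sup>2"
      if it: "i \<in> {1..N}" "S + \<tau>bar < t" and q: "1 \<le> q" and vC: "norm (v i t) \<le> C"
        and vq: "\<And>j \<sigma>. j \<in> {1..N} \<Longrightarrow> \<sigma> \<in> {0..\<tau>bar} \<Longrightarrow> norm (v j (t - \<sigma>)) \<le> q * norm (v i t)"
      for i t q
    proof -
      have t: "0 \<le> t" using it(2) S tau_bar_pos by simp
      have "v i t \<bullet> vel v i t \<le> (q - 1 - \<gamma> * \<phi> (norm (v i t))) * (norm (v i t))\<^sup>2"
      proof (rule agent_velocity_inner_le [OF t it(1) q])
        show "v 0 (t - \<sigma>) = 0" if "\<sigma> \<in> {0..\<tau>bar}" for \<sigma>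
          using leader [of "t - \<sigma>"] it(2) that by (simp add: v_def)
      qed (use v_cont vq in auto)
      also have "\<dots> \<le> (q - 1 - \<gamma> * \<phi> C) * (norm (v i t))\<^sup>2"
      proof (rule mult_right_mono)
        have "\<phi> C \<le> \<phi> (norm (v i t))" using phi_mono vC C by (auto simp: monotone_on_def)
        then show "q - 1 - \<gamma> * \<phi> (norm (v i t)) \<le> q - 1 - \<gamma> * \<phi> C" using gamma by simp
      qed simp
      finally show ?thesis unfolding v_def agent_velocity_translate .
    qed
  qed (use tau_bar_pos C v_cont in auto)
  then obtain \<mu> where \<mu>: "0 < \<mu>"
    and decay: "\<And>i t. i \<in> {1..N} \<Longrightarrow> S + \<tau>bar \<le> t \<Longrightarrow> norm (v i t) < C * exp (- \<mu> * (t - (S + \<tau>bar)))"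
    by blast
  have bound: "norm (x i t - xbar) \<le> C * exp (- \<mu> * (t - (S + \<tau>bar)))" if "S + \<tau>bar \<le> t" for t
  proof -
    have "x i t = y i t" using that S tau_bar_pos by (simp add: y_def max_absorb1)
    then show ?thesis
      using decay [of i t] leader [of t] i that tau_bar_pos C
      by (cases "i = 0") (auto simp: v_def intro: less_imp_le)
  qed
  have "((\<lambda>t. C * exp (- \<mu> * (t - (S + \<tau>bar)))) \<longlongrightarrow> 0) at_top"
    using \<mu> by real_asymp
  then have "((\<lambda>t. x i t - xbar) \<longlongrightarrow> 0) at_top"
    by (rule Lim_null_comparison [rotated]) (use bound in \<open>auto intro: eventually_at_top_linorderI\<close>)
  then show ?thesis by (simp add: LIM_zero_iff)
qed

end

section \<open>Steering to a prescribed consensus\<close>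

text \<open>
  The linearly decreasing speed has unit integral over \<open>[0, 1]\<close> and makes the control continuous, so that
  leader and agents can be treated alike.
\<close>
lemma integral_braking_ramp:
  fixes v :: "'a::euclidean_space"
  assumes "1 \<le> t"
  shows "integral {0..t} (\<lambda>s. (2 * max 0 (1 - s)) *\<^sub>R v) = v"
proof -
  let ?f = "\<lambda>s::real. (2 * max 0 (1 - s)) *\<^sub>R v"
  have "((\<lambda>s. (2 * (1 - s)) *\<^sub>R v) has_integral (2 * 1 - 1\<^sup>2) *\<^sub>R v - (2 * 0 - 0\<^sup>2) *\<^sub>R v) {0..1::real}"
    by (rule fundamental_theorem_of_calculus [where f = "\<lambda>s. (2 * s - s\<^sup>2) *\<^sub>R v"])
      (auto intro!: derivative_eq_intros simp: algebra_simps)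
  then have "(?f has_integral v) {0..1}"
    by (subst has_integral_cong [where g = "\<lambda>s. (2 * (1 - s)) *\<^sub>R v"]) auto
  moreover have "(?f has_integral 0) {1..t}"
    by (subst has_integral_cong [where g = "\<lambda>s. 0"]) auto
  ultimately have "(?f has_integral v + 0) {0..t}"
    by (intro has_integral_combine) (use assms in auto)
  then show ?thesis by (simp add: integral_unique)
qed

theorem theorem5p3:
  fixes N :: nat
    and \<gamma> \<tau>bar \<tau>star \<delta> r L B R R\<gamma> :: real
    and \<tau> \<beta> a \<phi> :: "real \<Rightarrow> real"
    and xin :: "nat \<Rightarrow> real \<Rightarrow> real ^ 'd"
    and xbar :: "real ^ 'd"
  assumes gamma: "\<gamma> > 0"
    and tau_bounds: "\<tau>bar > 0" "\<tau>star > 0" "\<forall>t\<ge>0. \<tau>star \<le> \<tau> t \<and> \<tau> t \<le> \<tau>bar"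
    and tau_cont: "continuous_on {0..} \<tau>"
    and beta_nonneg: "\<forall>s\<in>{0..\<tau>bar}. \<beta> s \<ge> 0"
    and beta_int: "set_integrable lebesgue {0..\<tau>bar} \<beta>"
    and beta_pos: "(LINT s:{0..\<tau>star}|lebesgue. \<beta> s) > 0"
    and a_nonneg: "\<forall>s\<ge>0. a s \<ge> 0"
    and a_cont: "continuous_on {0..} a"
    and a_mono: "antimono_on {0..} a"
    and a_range: "0 < \<delta>" "\<delta> < r" "\<forall>s\<in>{0..\<delta>}. a s = 1" "\<forall>s\<ge>r. a s = 0"
    and phi_pos: "\<forall>s\<ge>0. \<phi> s > 0"
    and phi_mono: "antimono_on {0..} \<phi>"
    and phi_lip: "L > 0" "L-lipschitz_on {0..} \<phi>"
    and phi_0: "\<phi> 0 = 1"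
    and xin_cont: "\<forall>i\<le>N. continuous_on {-\<tau>bar..0} (xin i)"
    and B: "B = (LINT s:{0..\<tau>bar}|lebesgue. \<beta> s)"
    and R: "R = (MAX i\<in>{0..N}. SUP s\<in>{-\<tau>bar..0}. norm (xin i s))"
    and R\<gamma>: "R\<gamma> = \<gamma> * L * R + \<gamma> + 1"
    and tau_small: "\<tau>bar < ln (1 + \<gamma> * \<phi> (2 * R) /
           (4 * R\<gamma> * B * (1 + \<gamma>) + \<gamma> * \<phi> (2 * R) * B * (1 + 2 * \<gamma>)))"
    and phi_delta: "\<phi> (\<delta> / 2) > 1 / (2 * \<gamma>)"
  shows "\<exists>u::real \<Rightarrow> real ^ 'd.
           u \<in> borel_measurable (lebesgue_on {0..}) \<and>
           (\<exists>x. is_solution N \<gamma> \<tau>bar \<tau> \<beta> a \<phi> xin u x) \<and>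
           (\<forall>x. is_solution N \<gamma> \<tau>bar \<tau> \<beta> a \<phi> xin u x \<longrightarrow>
                (\<forall>i\<le>N. (x i \<longlongrightarrow> xbar) at_top))"
proof -
  have a_le: "a s \<le> 1" if "0 \<le> s" for s
    using monotone_onD [OF a_mono, of 0 s] a_range(1,3) that by simp
  have phi_le: "\<phi> s \<le> 1" if "0 \<le> s" for s
    using monotone_onD [OF phi_mono, of 0 s] phi_0 that by simp
  interpret delayed_consensus N \<gamma> \<tau>bar \<tau>star \<tau> \<beta> a \<phi>
    by unfold_locales
      (use gamma tau_bounds tau_cont beta_nonneg beta_int beta_pos a_nonneg a_cont a_le
        phi_pos phi_le phi_mono lipschitz_on_continuous_on [OF phi_lip(2)] in auto)
  define v where "v = xbar - xin 0 0"
  define u where "u t = (2 * max 0 (1 - t)) *\<^sub>R v" for t :: real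
  have u_cont: "continuous_on UNIV u" unfolding u_def by (intro continuous_intros)
  have u_bound: "norm (u t) \<le> 2 * norm v" if "0 \<le> t" for t
    using mult_right_mono [of "max 0 (1 - t)" 1 "norm v"] that by (simp add: u_def)
  have reach: "xin 0 0 + integral {0..t} u = xbar" if "1 \<le> t" for t
    unfolding u_def integral_braking_ramp [OF that] by (simp add: v_def)
  show ?thesis
  proof (intro exI [of _ u] conjI allI impI)
    show "u \<in> borel_measurable (lebesgue_on {0..})"
      by (intro continuous_imp_measurable_on_sets_lebesgue continuous_on_subset [OF u_cont]) auto
    show "\<exists>x. is_solution N \<gamma> \<tau>bar \<tau> \<beta> a \<phi> xin u x"
      using is_solution_exists [OF u_cont u_bound] xin_cont by blast
    show "(x i \<longlongrightarrow> xbar) at_top"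
      if "is_solution N \<gamma> \<tau>bar \<tau> \<beta> a \<phi> xin u x" "i \<le> N" for x i
      using consensus_after_leader_stops [OF u_cont u_bound reach zero_le_one that] .
  qed
qed


end
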